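(* Let $p$ be a prime, $q=p^l$, $m\ge1$, $n=2m$. Let $r=\rho(q-1)$ with $0\leqslant\rho\leqslant n-1$ and $\rho=2\rho'$ even, and let $I\subseteq M_r$ with $\{0,2\}\cap I=\{0\}$. Then the minimum weight codewords of $\mathcal{C}_q(r,I,n)$ are exactly the vectors $x=(x_g)_{g\in\mathbb{F}_{q^n}}$ for which there exist $\lambda\in\mathbb{F}_q^*$, $h\in\mathbb{F}_{q^n}$ and an $\mathbb{F}_{q^2}$-subspace $V\subseteq\mathbb{F}_{q^n}$ of dimension $m-\rho'$ over $\mathbb{F}_{q^2}$ such that $x_g=\lambda$ for $g\in h+V$ and $x_g=0$ otherwise.
   Context: Let $N=q^n-1$ and $\alpha$ a primitive element of $\mathbb{F}_{q^n}$. Every integer $0\le u\le q^n-1$ is written $u=\sum_{i=0}^{n-1}u_iq^i$, $u_i\in\{0,\dots,q-1\}$; $\mathrm{wt}_q(u)=\sum u_i$, $O(u)=\sum_{i\text{ odd}}u_i$, $E(u)=\sum_{i\text{ even}}u_i$. For $-1\le r<n(q-1)$, $Z_r=\{\alpha^u\mid 0<u\le q^n-1,\ \mathrm{wt}_q(u)\le n(q-1)-r-1\}$. For $0\le r\le n(q-1)$ and integer $k\ge0$, $\Theta^{(r)}_k=\{\alpha^u\mid 0\le u\le q^n-1,\ \mathrm{wt}_q(u)=n(q-1)-r,\ |O(u)-E(u)|=k\}$. $M_r$ is the set of even (resp. odd) integers $k\in[0,m(q-1)]$ when $r$ is even (resp. odd). For $I\subseteq M_r$: $\overline I=M_r\setminus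 I$, $Z_{r,I}=Z_r\cup\bigcup_{k\in\overline I}\Theta^{(r)}_k$. $\mathcal{C}_q(r,I,n)^*$ is the cyclic code of length $N$ with coordinates indexed by $\mathbb{F}_{q^n}^*$ consisting of all $x=(x_g)$ with $\sum_g x_g g^{u}=0$ for every $u\in[1,N]$ with $\alpha^u\in Z_{r,I}$. $\mathcal{C}_q(r,I,n)$ is its extended code, with coordinates indexed by $\mathbb{F}_{q^n}$: a codeword $x$ of $\mathcal{C}_q(r,I,n)^*$ is extended by the coordinate $x_0=-\sum_{g\ne0}x_g$. Minimum weight is Hamming weight. *)

theory Defs
  imports Main "HOL-Computational_Algebra.Primes"
begin

definition qdigit :: "nat \<Rightarrow> nat \<Rightarrow> nat \<Rightarrow> nat" where
  "qdigit q i u = (u div q ^ i) mod q"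

definition wtq :: "nat \<Rightarrow> nat \<Rightarrow> nat \<Rightarrow> nat" where
  "wtq q n u = (\<Sum>i<n. qdigit q i u)"

definition Oq :: "nat \<Rightarrow> nat \<Rightarrow> nat \<Rightarrow> nat" where
  "Oq q n u = (\<Sum>i\<in>{i. i < n \<and> odd i}. qdigit q i u)"

definition Eq :: "nat \<Rightarrow> nat \<Rightarrow> nat \<Rightarrow> nat" where
  "Eq q n u = (\<Sum>i\<in>{i. i < n \<and> even i}. qdigit q i u)"

(* the subfield F_{q^k} of a field of characteristic p containing it *)
definition subfield_of_size :: "nat \<Rightarrow> 'a::field set" where
  "subfield_of_size s = {x. x ^ s = x}"

definition primitive_elem :: "'a::{field,finite} \<Rightarrow> bool" where
  "primitive_elem \<alpha> \<longleftrightarrow> \<alpha> \<noteq> 0 \<and> (\<forall>k. 0 < k \<and> k < card (UNIV :: 'a set) - 1 \<longrightarrow> \<alpha> ^ k \<noteq> 1)"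

definition Zset :: "nat \<Rightarrow> nat \<Rightarrow> 'a::field \<Rightarrow> nat \<Rightarrow> 'a set" where
  "Zset q n \<alpha> r = {\<alpha> ^ u | u. 0 < u \<and> u \<le> q ^ n - 1 \<and> wtq q n u + r + 1 \<le> n * (q - 1)}"

definition Theta :: "nat \<Rightarrow> nat \<Rightarrow> 'a::field \<Rightarrow> nat \<Rightarrow> nat \<Rightarrow> 'a set" where
  "Theta q n \<alpha> r k = {\<alpha> ^ u | u. u \<le> q ^ n - 1 \<and> wtq q n u + r = n * (q - 1)
       \<and> \<bar>int (Oq q n u) - int (Eq q n u)\<bar> = int k}"

definition Mset :: "nat \<Rightarrow> nat \<Rightarrow> nat \<Rightarrow> nat set" where
  "Mset q m r = {k. k \<le> m * (q - 1) \<and> (even k \<longleftrightarrow> even r)}"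

definition ZrI :: "nat \<Rightarrow> nat \<Rightarrow> 'a::field \<Rightarrow> nat \<Rightarrow> nat set \<Rightarrow> 'a set" where
  "ZrI q n \<alpha> r I = Zset q n \<alpha> r \<union> (\<Union>k\<in>Mset q (n div 2) r - I. Theta q n \<alpha> r k)"

(* The extended code C_q(r,I,n): words x indexed by the field, entries in F_q,
   whose restriction to the nonzero elements lies in C_q(r,I,n)^* and with
   x_0 = - sum_{g<>0} x_g. *)
definition Ccode :: "nat \<Rightarrow> nat \<Rightarrow> 'a::field \<Rightarrow> nat \<Rightarrow> nat set \<Rightarrow> ('a \<Rightarrow> 'a) set" where
  "Ccode q n \<alpha> r I = {x. (\<forall>g. x g \<in> subfield_of_size q)
      \<and> (\<forall>u\<in>{1..q ^ n - 1}. \<alpha> ^ u \<in> ZrI q n \<alpha> r I \<longrightarrow> (\<Sum>g\<in>UNIV - {0}. x g * g ^ u) = 0)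
      \<and> x 0 = - (\<Sum>g\<in>UNIV - {0}. x g)}"

definition hweight :: "('a \<Rightarrow> 'b::zero) \<Rightarrow> nat" where
  "hweight x = card {g. x g \<noteq> 0}"

definition min_weight_words :: "('a \<Rightarrow> 'b::zero) set \<Rightarrow> ('a \<Rightarrow> 'b) set" where
  "min_weight_words C = {x \<in> C. x \<noteq> (\<lambda>_. 0) \<and>
      (\<forall>y\<in>C. y \<noteq> (\<lambda>_. 0) \<longrightarrow> hweight x \<le> hweight y)}"

definition is_subspace_over :: "'a::field set \<Rightarrow> 'a set \<Rightarrow> bool" where
  "is_subspace_over K V \<longleftrightarrow> 0 \<in> V \<and> (\<forall>v\<in>V. \<forall>w\<in>V. v + w \<in> V) \<and> (\<forall>c\<in>K. \<forall>v\<in>V. c * v \<in> V)"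

definition span_over :: "'a::field set \<Rightarrow> 'a set \<Rightarrow> 'a set" where
  "span_over K B = {\<Sum>b\<in>B. c b * b | c. \<forall>b\<in>B. c b \<in> K}"

definition indep_over :: "'a::field set \<Rightarrow> 'a set \<Rightarrow> bool" where
  "indep_over K B \<longleftrightarrow> (\<forall>c. (\<forall>b\<in>B. c b \<in> K) \<and> (\<Sum>b\<in>B. c b * b) = 0 \<longrightarrow> (\<forall>b\<in>B. c b = 0))"

definition dim_over :: "'a::field set \<Rightarrow> 'a set \<Rightarrow> nat \<Rightarrow> bool" where
  "dim_over K V d \<longleftrightarrow> (\<exists>B. finite B \<and> card B = d \<and> B \<subseteq> V \<and> indep_over K B \<and> span_over K B = V)"

end

theory Submission
  imports Defs "HOL-Computational_Algebra.Polynomial" "HOL-Library.FuncSet"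
    "HOL-Library.Function_Algebras"
begin

text \<open>
  Put \<open>k = n - \<rho> = 2 d\<close>. For \<open>u < q ^ k - 1\<close> the \<open>q\<close>-weight of \<open>u\<close> is below \<open>k (q - 1)\<close>, so the
  BCH bound gives minimum weight at least \<open>q ^ k\<close>. For a word of weight exactly \<open>q ^ k\<close>, the
  vanishing power sums between \<open>q ^ k - 1\<close> and \<open>2 (q ^ k - 1)\<close> and Newton's identities force the
  polynomial with the support as its set of roots to be an affine linearized polynomial. Hence the
  support is a coset \<open>h + V\<close> of an \<open>F_q\<close>-subspace, and the word is constant there.

  If \<open>V\<close> is an \<open>F_{q^2}\<close>-subspace, then \<open>g ^ u\<close> is a product of \<open>E(u) + q O(u)\<close> functions that are
  affine over \<open>F_{q^2}\<close>, and its \<open>q\<close>-th power one of \<open>q E(u) + O(u)\<close>. A product of fewer than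
  \<open>d (q^2 - 1)\<close> such functions sums to zero over \<open>h + V\<close>, so the sum of \<open>g ^ u\<close> can be nonzero at weight
  \<open>k (q - 1)\<close> only if \<open>E(u) = O(u)\<close>.

  Conversely let \<open>A\<close> and \<open>B\<close> be the spans of the functions \<open>v ^ (q ^ i)\<close> on \<open>V\<close> with \<open>i\<close> even and
  odd. Together they span the \<open>k\<close>-dimensional space of \<open>F_q\<close>-linear functions on \<open>V\<close>, and the Frobenius
  map shows \<open>dim A = dim B\<close>. The sum over \<open>V\<close> of the product of the \<open>(q - 1)\<close>-th powers of a basis is
  nonzero. If \<open>A\<close> and \<open>B\<close> met nontrivially, this product could be written with \<open>d (q - 1) + 1\<close> factors in
  \<open>A\<close> and \<open>d (q - 1) - 1\<close> in \<open>B\<close>, contradicting the parity checks with \<open>|O(u) - E(u)| = 2\<close>. So \<open>A\<close> and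
  \<open>B\<close> meet in \<open>0\<close>, the even and odd parts of a linearized polynomial with zero set \<open>V\<close> both vanish
  on \<open>V\<close>, and \<open>V\<close> is stable under \<open>F_{q^2}\<close>.
\<close>

subsection \<open>Linear algebra over a subfield of a finite field\<close>

lemma prime_CHAR_finite_field: "prime CHAR('a::{field,finite})"
  by (rule prime_CHAR_semidom, rule finite_imp_CHAR_pos) auto

lemma CHAR_eq_of_card:
  assumes "prime p" "card (UNIV :: 'a::{field,finite} set) = p ^ N"
  shows "CHAR('a) = p"
proof -
  have "(\<Sum>x\<in>UNIV. x) = (\<Sum>x\<in>(UNIV::'a set). x + 1)"
    by (rule sum.reindex_bij_witness[of _ "\<lambda>x. x + 1" "\<lambda>x. x - 1"]) auto
  hence "of_nat (card (UNIV :: 'a set)) = (0 :: 'a)"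
    by (simp add: sum.distrib)
  hence "CHAR('a) dvd p ^ N"
    using of_nat_eq_0_iff_char_dvd assms(2) by metis
  thus ?thesis
    using assms(1) prime_CHAR_finite_field prime_dvd_power primes_dvd_imp_eq by metis
qed

lemma power_card_field: "x ^ card (UNIV :: 'a set) = (x :: 'a::{field,finite})"
proof (cases "x = 0")
  case False
  have "(\<Prod>y\<in>UNIV-{0}. x * y) = (\<Prod>y\<in>UNIV-{0}. y)"
    by (rule prod.reindex_bij_witness[of _ "\<lambda>y. y / x" "\<lambda>y. x * y"]) (use False in auto)
  hence "x ^ (card (UNIV :: 'a set) - 1) * \<Prod>(UNIV-{0}) = (\<Prod>y\<in>UNIV-{0}. y)"
    by (simp add: prod.distrib)
  hence "x ^ (card (UNIV :: 'a set) - 1) = 1"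
    by simp
  thus ?thesis
    by (metis finite_UNIV_card_ge_0 finite mult.right_neutral power_minus_mult mult.commute)
qed (simp add: finite_UNIV_card_ge_0)

lemma primitive_elem_inj:
  assumes "primitive_elem (\<alpha> :: 'a::{field,finite})"
  shows "inj_on (\<lambda>j. \<alpha> ^ j) {..<card (UNIV :: 'a set) - 1}"
proof -
  have a0: "\<alpha> \<noteq> 0" using assms by (auto simp: primitive_elem_def)
  have ne: "\<alpha> ^ i \<noteq> \<alpha> ^ j" if "i < j" "j < card (UNIV :: 'a set) - 1" for i j
  proof
    assume eq: "\<alpha> ^ i = \<alpha> ^ j"
    have "\<alpha> ^ j = \<alpha> ^ i * \<alpha> ^ (j - i)" using that(1) by (simp flip: power_add)
    hence "\<alpha> ^ (j - i) = 1" using eq a0 by simp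
    thus False using assms that unfolding primitive_elem_def by simp
  qed
  show ?thesis
    by (rule inj_onI) (metis ne lessThan_iff linorder_neqE_nat)
qed

lemma primitive_elem_generates:
  assumes "primitive_elem (\<alpha> :: 'a::{field,finite})" "g \<noteq> 0"
  shows "\<exists>i. g = \<alpha> ^ i"
proof -
  let ?P = "(\<lambda>j. \<alpha> ^ j) ` {..<card (UNIV :: 'a set) - 1}"
  have "?P \<subseteq> UNIV - {0}" using assms(1) by (auto simp: primitive_elem_def)
  moreover have "card ?P = card (UNIV - {0 :: 'a})"
    using card_image[OF primitive_elem_inj[OF assms(1)]] by simp
  ultimately have "?P = UNIV - {0}" by (intro card_subset_eq) auto
  thus ?thesis using assms(2) by blast
qed

text \<open>With \<open>t = (card UNIV - 1) / (s - 1)\<close>, the elements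
  \<open>\<alpha> ^ (j * t)\<close> for \<open>j < s - 1\<close> are distinct. Together with 0 they
  are \<open>s\<close> roots of \<open>X ^ s - X\<close>, whose degree allows no more.\<close>

lemma card_subfield_of_size:
  assumes "primitive_elem (\<alpha> :: 'a::{field,finite})" "s \<ge> 2"
    and "s - 1 dvd card (UNIV :: 'a set) - 1"
  shows "card (subfield_of_size s :: 'a set) = s"
proof -
  let ?Q = "card (UNIV :: 'a set)"
  have Q: "?Q \<ge> 2"
    using card_mono[of "UNIV :: 'a set" "{0, 1}"] by simp
  obtain t where t: "?Q - 1 = (s - 1) * t"
    using assms(3) by blast
  have t0: "t > 0" using t Q by (cases t) auto
  have a0: "\<alpha> \<noteq> 0" using assms(1) by (auto simp: primitive_elem_def)
  have aQ: "\<alpha> ^ (?Q - 1) = 1"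
  proof -
    have "\<alpha> * \<alpha> ^ (?Q - 1) = \<alpha> * 1"
      using power_card_field[of \<alpha>] Q by (simp flip: power_Suc)
    thus ?thesis using a0 by simp
  qed
  define f where "f j = \<alpha> ^ (j * t)" for j
  have inj: "inj_on f {..<s-1}"
  proof (rule inj_onI)
    fix i j assume ij: "i \<in> {..<s-1}" "j \<in> {..<s-1}" "f i = f j"
    hence "i * t \<in> {..<?Q - 1}" "j * t \<in> {..<?Q - 1}" using t t0 by simp_all
    hence "i * t = j * t"
      using ij(3) unfolding f_def by (intro inj_onD[OF primitive_elem_inj[OF assms(1)]])
    thus "i = j" using t0 by simp
  qed
  have pw: "x ^ s = x \<longleftrightarrow> x = 0 \<or> x ^ (s - 1) = 1" for x :: 'a
  proof -
    have "x ^ s = x * x ^ (s - 1)" using assms(2) by (simp flip: power_Suc)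
    thus ?thesis by auto
  qed
  have sub: "insert 0 (f ` {..<s-1}) \<subseteq> subfield_of_size s"
  proof -
    have "f j ^ (s - 1) = 1" for j
    proof -
      have "f j ^ (s - 1) = (\<alpha> ^ (?Q - 1)) ^ j"
        unfolding f_def t by (simp add: ac_simps flip: power_mult)
      thus ?thesis using aQ by simp
    qed
    thus ?thesis unfolding subfield_of_size_def using pw by auto
  qed
  have "s \<le> card (subfield_of_size s :: 'a set)"
  proof -
    have "card (insert 0 (f ` {..<s-1})) = s"
    proof -
      have "0 \<notin> f ` {..<s-1}" using a0 by (auto simp: f_def)
      moreover have "card (f ` {..<s-1}) = s - 1" using card_image[OF inj] by simp
      ultimately show ?thesis using assms(2) by simp
    qed
    thus ?thesis using card_mono[OF _ sub] by simp
  qed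
  moreover have "card (subfield_of_size s :: 'a set) \<le> s"
  proof -
    let ?p = "monom 1 s - monom 1 1 :: 'a poly"
    have c: "coeff ?p s = 1" using assms(2) by simp
    hence "?p \<noteq> 0" by (metis coeff_0 zero_neq_one)
    from card_poly_roots_bound[OF this]
    have "card {x. poly ?p x = 0} \<le> degree ?p" .
    also have "\<dots> \<le> s"
      by (rule degree_diff_le) (use assms(2) in \<open>auto simp: degree_monom_eq\<close>)
    finally show ?thesis by (simp add: subfield_of_size_def poly_monom)
  qed
  ultimately show ?thesis by simp
qed

lemma frobenius_add:
  assumes "s = CHAR('a::{field,finite}) ^ e"
  shows "(x + y :: 'a) ^ (s ^ i) = x ^ (s ^ i) + y ^ (s ^ i)"
  using freshmans_dream'[where ?'a = 'a, OF prime_CHAR_finite_field, of "s ^ i" "e * i"] assms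
  by (simp add: power_mult)

lemma frobenius_sum:
  assumes "s = CHAR('a::{field,finite}) ^ e"
  shows "(sum f A :: 'a) ^ (s ^ i) = (\<Sum>x\<in>A. f x ^ (s ^ i))"
  using freshmans_dream_sum'[where ?'a = 'a, OF prime_CHAR_finite_field, of "s ^ i" "e * i"] assms
  by (simp add: power_mult)

definition linear_over :: "'a::field set \<Rightarrow> 'a set \<Rightarrow> ('a \<Rightarrow> 'a) \<Rightarrow> bool" where
  "linear_over K V f \<longleftrightarrow> (\<forall>v\<in>V. \<forall>w\<in>V. f (v + w) = f v + f w) \<and> (\<forall>c\<in>K. \<forall>v\<in>V. f (c * v) = c * f v)"

text \<open>To be instantiated with \<open>q\<close> and with \<open>q ^ 2\<close>. The assumption
  \<open>card_K\<close> says that all roots of \<open>X ^ s - X\<close> lie in the ambient field, so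
  that \<open>K\<close> is the field of \<open>s\<close> elements.\<close>

locale finite_subfield =
  fixes s :: nat and F :: "'a::{field,finite} itself" and K :: "'a set"
  assumes s_power: "\<exists>e. s = CHAR('a) ^ e"
    and K_def: "K = subfield_of_size s"
    and card_K: "card K = s"
    and s_ge_2: "s \<ge> 2"
begin

lemma K_iff: "x \<in> K \<longleftrightarrow> x ^ s = x"
  by (simp add: K_def subfield_of_size_def)

lemma pow_s_add: "(x + y :: 'a) ^ (s ^ i) = x ^ (s ^ i) + y ^ (s ^ i)"
  using s_power frobenius_add by blast

lemma K_pow: "x \<in> K \<Longrightarrow> x ^ (s ^ i) = x"
  by (induction i) (auto simp: K_iff power_mult)

lemma K_zero: "0 \<in> K" and K_one: "1 \<in> K"
  using s_ge_2 by (auto simp: K_iff)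

lemma K_add: "x \<in> K \<Longrightarrow> y \<in> K \<Longrightarrow> x + y \<in> K"
  using pow_s_add[of x y 1] by (simp add: K_iff)

lemma K_mult: "x \<in> K \<Longrightarrow> y \<in> K \<Longrightarrow> x * y \<in> K"
  by (simp add: K_iff power_mult_distrib)

lemma K_uminus: "x \<in> K \<Longrightarrow> - x \<in> K"
proof -
  assume x: "x \<in> K"
  have "(x + - x) ^ (s ^ 1) = x ^ (s ^ 1) + (- x) ^ (s ^ 1)"
    by (rule pow_s_add)
  hence "x + (- x) ^ s = 0" using x s_ge_2 by (simp add: K_iff power_0_left)
  thus ?thesis by (simp add: K_iff eq_neg_iff_add_eq_0 add.commute)
qed

lemma K_diff: "x \<in> K \<Longrightarrow> y \<in> K \<Longrightarrow> x - y \<in> K"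
  using K_add[of x "- y"] K_uminus by simp

lemma K_inverse: "x \<in> K \<Longrightarrow> inverse x \<in> K"
  by (simp add: K_iff power_inverse)

lemma K_pow_minus1: "x \<in> K \<Longrightarrow> x \<noteq> 0 \<Longrightarrow> x ^ (s - 1) = 1"
  using s_ge_2 unfolding K_iff by (cases s) auto

text \<open>Multiplication by a nonzero \<open>c\<close> in \<open>K\<close> permutes
  \<open>K\<close> and multiplies the sum by \<open>c ^ t\<close>; for \<open>0 < t < s - 1\<close>
  some \<open>c\<close> has \<open>c ^ t \<noteq> 1\<close>, as \<open>X ^ t - 1\<close> has at most
  \<open>t\<close> roots. For \<open>t = 0\<close> the sum is the cardinality of \<open>K\<close>,
  which translation by 1 shows to be zero in the field.\<close>

lemma power_sum_0:
  assumes "t < s - 1"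
  shows "(\<Sum>x\<in>K. x ^ t) = 0"
proof (cases "t = 0")
  case True
  have "(\<Sum>x\<in>K. x) = (\<Sum>x\<in>K. x + 1)"
    by (rule sum.reindex_bij_witness[of _ "\<lambda>x. x + 1" "\<lambda>x. x - 1"])
      (auto intro: K_add K_diff K_one)
  thus ?thesis using True by (simp add: sum.distrib)
next
  case False
  let ?p = "monom 1 t - 1 :: 'a poly"
  have "coeff ?p t = 1" using False by simp
  hence "?p \<noteq> 0" by (metis coeff_0 zero_neq_one)
  from card_poly_roots_bound[OF this]
  have "card {x. poly ?p x = 0} \<le> degree ?p" .
  also have "\<dots> \<le> t"
    by (rule degree_diff_le) (auto simp: degree_monom_eq)
  also have "\<dots> < card (K - {0})"
    using assms K_zero by (simp add: card_K)
  finally have "\<not> K - {0} \<subseteq> {x. poly ?p x = 0}"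
    by (meson card_mono finite leD)
  then obtain c where c: "c \<in> K" "c \<noteq> 0" "c ^ t \<noteq> 1"
    by (auto simp: poly_monom)
  have "(\<Sum>x\<in>K. x ^ t) = (\<Sum>x\<in>K. (c * x) ^ t)"
    by (rule sum.reindex_bij_witness[of _ "\<lambda>x. c * x" "\<lambda>x. inverse c * x"])
      (use c in \<open>auto intro: K_mult K_inverse simp flip: mult.assoc\<close>)
  also have "\<dots> = c ^ t * (\<Sum>x\<in>K. x ^ t)"
    by (simp add: power_mult_distrib sum_distrib_left)
  finally show ?thesis using c(3) by (simp add: algebra_simps)
qed

section \<open>Subspaces, bases and dimension over the subfield\<close>

abbreviation "subsp \<equiv> is_subspace_over K"
abbreviation "indep \<equiv> indep_over K"
abbreviation "spanK \<equiv> span_over K"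
abbreviation "lin \<equiv> linear_over K"

lemma subsp_sum: "subsp V \<Longrightarrow> (\<And>b. b \<in> B \<Longrightarrow> f b \<in> V) \<Longrightarrow> sum f B \<in> V"
  by (induction B rule: infinite_finite_induct) (auto simp: is_subspace_over_def)

lemma subsp_uminus: "subsp V \<Longrightarrow> v \<in> V \<Longrightarrow> - v \<in> V"
  using K_uminus[OF K_one] unfolding is_subspace_over_def by (metis mult_minus1)

lemma subsp_diff: "subsp V \<Longrightarrow> v \<in> V \<Longrightarrow> w \<in> V \<Longrightarrow> v - w \<in> V"
  using subsp_uminus[of V w] unfolding is_subspace_over_def by (metis add_uminus_conv_diff)

lemma subsp_span: "subsp (spanK B)"
  unfolding is_subspace_over_def
proof (intro conjI ballI)
  show "0 \<in> spanK B"
    unfolding span_over_def by (auto intro!: exI[of _ "\<lambda>_. 0"] K_zero)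
next
  fix v w assume "v \<in> spanK B" "w \<in> spanK B"
  then obtain c d where "v = (\<Sum>b\<in>B. c b * b)" "w = (\<Sum>b\<in>B. d b * b)"
    "\<forall>b\<in>B. c b \<in> K" "\<forall>b\<in>B. d b \<in> K"
    unfolding span_over_def by auto
  thus "v + w \<in> spanK B"
    unfolding span_over_def
    by (auto intro!: exI[of _ "\<lambda>b. c b + d b"] K_add simp: sum.distrib distrib_right)
next
  fix a v assume "a \<in> K" "v \<in> spanK B"
  then obtain c where "v = (\<Sum>b\<in>B. c b * b)" "\<forall>b\<in>B. c b \<in> K"
    unfolding span_over_def by auto
  thus "a * v \<in> spanK B"
    unfolding span_over_def using \<open>a \<in> K\<close>
    by (auto intro!: exI[of _ "\<lambda>b. a * c b"] K_mult simp: sum_distrib_left mult.assoc)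
qed

lemma span_minimal: "subsp V \<Longrightarrow> B \<subseteq> V \<Longrightarrow> spanK B \<subseteq> V"
  unfolding span_over_def by (auto intro!: subsp_sum simp: is_subspace_over_def)

lemma indep_insert:
  assumes B: "indep B" "v \<notin> spanK B"
  shows "indep (insert v B)"
  unfolding indep_over_def
proof (intro allI impI, elim conjE)
  fix c assume c: "\<forall>b\<in>insert v B. c b \<in> K" and z: "(\<Sum>b\<in>insert v B. c b * b) = 0"
  show "\<forall>b\<in>insert v B. c b = 0"
  proof (cases "v \<in> B")
    case True
    thus ?thesis using B c z unfolding indep_over_def by (simp add: insert_absorb)
  next
    case False
    have z': "c v * v + (\<Sum>b\<in>B. c b * b) = 0" using z False by simp
    have "c v = 0"
    proof (rule ccontr)
      assume cv: "c v \<noteq> 0"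
      have in_span: "(\<Sum>b\<in>B. c b * b) \<in> spanK B"
        unfolding span_over_def using c by auto
      have "v = (- inverse (c v)) * (\<Sum>b\<in>B. c b * b)"
        using z' cv by (simp add: field_simps eq_neg_iff_add_eq_0)
      moreover have "\<dots> \<in> spanK B"
        using subsp_span[of B] in_span c K_uminus[OF K_inverse]
        unfolding is_subspace_over_def by blast
      ultimately show False using B(2) by simp
    qed
    thus ?thesis using z' B(1) c unfolding indep_over_def by simp
  qed
qed

lemma subset_spanK: "B \<subseteq> spanK B"
proof
  fix v assume v: "v \<in> B"
  show "v \<in> spanK B"
    unfolding span_over_def
    by (rule CollectI, rule exI[of _ "\<lambda>b. if b = v then 1 else 0"])
      (use v in \<open>auto simp: if_distrib[of "\<lambda>x. x * _"] K_one K_zero cong: if_cong\<close>)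
qed

lemma basis_exists:
  assumes "subsp V"
  obtains B where "B \<subseteq> V" "indep B" "spanK B = V"
proof -
  let ?P = "\<lambda>B. B \<subseteq> V \<and> indep B"
  have "?P {}" by (auto simp: indep_over_def)
  moreover have "\<forall>B. ?P B \<longrightarrow> card B \<le> card V"
    by (auto intro: card_mono)
  ultimately obtain B where B: "?P B" and max: "\<forall>C. ?P C \<longrightarrow> card C \<le> card B"
    using ex_has_greatest_nat[of ?P "{}" card "card V + 1"] by (metis le_imp_less_Suc Suc_eq_plus1)
  have "v \<in> spanK B" if v: "v \<in> V" for v
  proof (rule ccontr)
    assume n: "v \<notin> spanK B"
    hence "v \<notin> B" using subset_spanK by blast
    moreover have "?P (insert v B)" using indep_insert n B v by auto
    ultimately show False using max by (metis card_insert_disjoint finite Suc_n_not_le_n)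
  qed
  thus ?thesis using that B span_minimal[OF assms, of B] by blast
qed

text \<open>Extensional functions serve as coordinate vectors, so that sums over a subspace become
  sums over \<open>B \<rightarrow>\<^sub>E K\<close>.\<close>

lemma bij_coordinates:
  assumes "indep B"
  shows "bij_betw (\<lambda>c. \<Sum>b\<in>B. c b * b) (B \<rightarrow>\<^sub>E K) (spanK B)"
  unfolding bij_betw_def
proof
  show "inj_on (\<lambda>c. \<Sum>b\<in>B. c b * b) (B \<rightarrow>\<^sub>E K)"
  proof (rule inj_onI)
    fix c d assume c: "c \<in> B \<rightarrow>\<^sub>E K" and d: "d \<in> B \<rightarrow>\<^sub>E K"
      and eq: "(\<Sum>b\<in>B. c b * b) = (\<Sum>b\<in>B. d b * b)"
    have "(\<Sum>b\<in>B. (c b - d b) * b) = 0"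
      using eq by (simp add: left_diff_distrib sum_subtractf)
    moreover have "\<forall>b\<in>B. c b - d b \<in> K" using c d by (auto intro: K_diff)
    ultimately have "\<forall>b\<in>B. c b - d b = 0"
      using assms[unfolded indep_over_def, rule_format, of "\<lambda>b. c b - d b"] by blast
    thus "c = d" using c d by (intro PiE_ext) auto
  qed
next
  show "(\<lambda>c. \<Sum>b\<in>B. c b * b) ` (B \<rightarrow>\<^sub>E K) = spanK B"
  proof (intro subset_antisym subsetI)
    fix v assume "v \<in> (\<lambda>c. \<Sum>b\<in>B. c b * b) ` (B \<rightarrow>\<^sub>E K)"
    thus "v \<in> spanK B" unfolding span_over_def by auto
  next
    fix v assume "v \<in> spanK B"
    then obtain c where c: "v = (\<Sum>b\<in>B. c b * b)" "\<forall>b\<in>B. c b \<in> K"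
      unfolding span_over_def by auto
    thus "v \<in> (\<lambda>c. \<Sum>b\<in>B. c b * b) ` (B \<rightarrow>\<^sub>E K)"
      by (intro image_eqI[of _ _ "restrict c B"]) auto
  qed
qed

lemma indep_subset:
  assumes "indep B" "C \<subseteq> B"
  shows "indep C"
  unfolding indep_over_def
proof (intro allI impI, elim conjE)
  fix c assume c: "\<forall>b\<in>C. c b \<in> K" "(\<Sum>b\<in>C. c b * b) = 0"
  let ?c = "\<lambda>b. if b \<in> C then c b else 0"
  have "(\<Sum>b\<in>B. ?c b * b) = (\<Sum>b\<in>C. ?c b * b)"
    using assms(2) by (intro sum.mono_neutral_right) auto
  hence "(\<Sum>b\<in>B. ?c b * b) = 0" using c(2) by simp
  moreover have "\<forall>b\<in>B. ?c b \<in> K" using c(1) K_zero by auto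
  ultimately have "\<forall>b\<in>B. ?c b = 0"
    using assms(1)[unfolded indep_over_def, rule_format, of ?c] by blast
  thus "\<forall>b\<in>C. c b = 0" using assms(2) by (auto split: if_splits)
qed

lemma card_span: "indep B \<Longrightarrow> card (spanK B) = s ^ card B"
  using bij_betw_same_card[OF bij_coordinates] by (simp add: card_PiE card_K)

lemma dim_over_iff: "subsp V \<Longrightarrow> dim_over K V d \<longleftrightarrow> card V = s ^ d"
proof
  assume "dim_over K V d"
  thus "card V = s ^ d" using card_span unfolding dim_over_def by auto
next
  assume V: "subsp V" and c: "card V = s ^ d"
  obtain B where B: "B \<subseteq> V" "indep B" "spanK B = V" using basis_exists[OF V] .
  have "card B = d"
    using card_span[OF B(2)] B(3) c s_ge_2 power_inject_exp[of s] by simp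
  thus "dim_over K V d" unfolding dim_over_def using B by auto
qed

lemma exists_subspace_of_dim:
  assumes "card (UNIV :: 'a set) = s ^ m" "d \<le> m"
  shows "\<exists>V. subsp V \<and> card V = s ^ d"
proof -
  have "subsp UNIV" by (auto simp: is_subspace_over_def)
  then obtain B where B: "indep B" "spanK B = UNIV" using basis_exists by metis
  have "card B = m"
    using card_span[OF B(1)] B(2) assms(1) s_ge_2 power_inject_exp[of s] by simp
  then obtain C where C: "C \<subseteq> B" "card C = d"
    using obtain_subset_with_card_n[of d B] assms(2) by auto
  thus ?thesis using card_span[OF indep_subset[OF B(1) C(1)]] subsp_span by metis
qed

section \<open>Sums over a subspace of products of linear functions\<close>

lemma lin_sum:
  assumes "subsp V" "lin V f" "B \<subseteq> V" "\<And>b. b \<in> B \<Longrightarrow> c b \<in> K"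
  shows "f (\<Sum>b\<in>B. c b * b) = (\<Sum>b\<in>B. c b * f b)"
proof -
  have f0: "f 0 = 0"
    using assms(1,2) K_zero unfolding linear_over_def is_subspace_over_def by (metis mult_zero_left)
  have "finite B" by simp
  thus ?thesis using assms(3,4)
  proof (induction B rule: finite_induct)
    case (insert x B)
    have x: "c x * x \<in> V" "x \<in> V" "c x \<in> K"
      using insert.prems assms(1) unfolding is_subspace_over_def by auto
    have "(\<Sum>b\<in>B. c b * b) \<in> V"
      by (rule subsp_sum[OF assms(1)]) (use insert.prems assms(1) in \<open>auto simp: is_subspace_over_def\<close>)
    hence "f (c x * x + (\<Sum>b\<in>B. c b * b)) = c x * f x + f (\<Sum>b\<in>B. c b * b)"
      using x assms(2) unfolding linear_over_def by simp
    thus ?case using insert by simp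
  qed (use f0 in auto)
qed

lemma sum_coordinate_monomial:
  "finite B \<Longrightarrow> (\<Sum>a\<in>B \<rightarrow>\<^sub>E K. \<Prod>b\<in>B. a b ^ e b) = (\<Prod>b\<in>B. \<Sum>x\<in>K. x ^ e b)"
  by (rule prod_sum_PiE[symmetric]) auto

text \<open>In coordinates the product expands into monomials of total degree \<open>card T\<close>.
  There are \<open>k\<close> variables, so in each monomial one of them has an exponent below
  \<open>s - 1\<close>, and its power sum over \<open>K\<close> vanishes.\<close>

lemma sum_prod_linear_0:
  assumes V: "subsp V" "card V = s ^ k" and T: "finite T" "card T < k * (s - 1)"
    and f: "\<And>i. i \<in> T \<Longrightarrow> lin V (f i)"
  shows "(\<Sum>v\<in>V. \<Prod>i\<in>T. f i v) = 0"
proof -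
  obtain B where B: "B \<subseteq> V" "indep B" "spanK B = V" using basis_exists[OF V(1)] .
  have cB: "card B = k"
    using card_span[OF B(2)] B(3) V(2) s_ge_2 power_inject_exp[of s] by simp
  have "(\<Sum>v\<in>V. \<Prod>i\<in>T. f i v) = (\<Sum>a\<in>B \<rightarrow>\<^sub>E K. \<Prod>i\<in>T. f i (\<Sum>b\<in>B. a b * b))"
    using sum.reindex_bij_betw[OF bij_coordinates[OF B(2)], symmetric] B(3) by simp
  also have "\<dots> = (\<Sum>a\<in>B \<rightarrow>\<^sub>E K. \<Prod>i\<in>T. \<Sum>b\<in>B. a b * f i b)"
    by (intro sum.cong prod.cong refl lin_sum[OF V(1) f B(1)]) auto
  also have "\<dots> = (\<Sum>a\<in>B \<rightarrow>\<^sub>E K. \<Sum>\<phi>\<in>T \<rightarrow>\<^sub>E B. \<Prod>i\<in>T. a (\<phi> i) * f i (\<phi> i))"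
    by (intro sum.cong refl prod_sum_PiE T) auto
  also have "\<dots> = (\<Sum>\<phi>\<in>T \<rightarrow>\<^sub>E B. (\<Prod>i\<in>T. f i (\<phi> i)) * (\<Sum>a\<in>B \<rightarrow>\<^sub>E K. \<Prod>i\<in>T. a (\<phi> i)))"
    by (subst sum.swap) (simp add: prod.distrib sum_distrib_left mult.commute)
  also have "\<dots> = 0"
  proof (intro sum.neutral ballI)
    fix \<phi> assume \<phi>: "\<phi> \<in> T \<rightarrow>\<^sub>E B"
    \<comment> \<open>\<open>\<phi>\<close> picks a coordinate from each factor; \<open>e b\<close>
      is the exponent of coordinate \<open>b\<close> in the resulting monomial.\<close>
    define e where "e b = card {i\<in>T. \<phi> i = b}" for b
    have "(\<Prod>i\<in>T. a (\<phi> i)) = (\<Prod>b\<in>B. a b ^ e b)" for a :: "'a \<Rightarrow> 'a"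
    proof -
      have "(\<Prod>b\<in>B. a b ^ e b) = (\<Prod>b\<in>B. \<Prod>i\<in>{i\<in>T. \<phi> i = b}. a (\<phi> i))"
        by (simp add: e_def)
      also have "\<dots> = (\<Prod>i\<in>T. a (\<phi> i))"
        using \<phi> T(1) by (intro prod.group) auto
      finally show ?thesis ..
    qed
    moreover have "(\<Prod>b\<in>B. \<Sum>x\<in>K. x ^ e b) = 0"
    proof -
      have "card T = (\<Sum>b\<in>B. e b)"
        using sum.group[OF T(1) _, of B \<phi> "\<lambda>i. 1::nat"] PiE_mem[OF \<phi>]
        by (simp add: e_def image_subset_iff)
      have "\<exists>b\<in>B. e b < s - 1"
      proof (rule ccontr)
        assume "\<not> ?thesis"
        hence "(\<Sum>b\<in>B. s - 1) \<le> (\<Sum>b\<in>B. e b)" by (intro sum_mono) auto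
        thus False using \<open>card T = _\<close> T(2) cB by simp
      qed
      thus ?thesis using power_sum_0 by auto
    qed
    ultimately show "(\<Prod>i\<in>T. f i (\<phi> i)) * (\<Sum>a\<in>B \<rightarrow>\<^sub>E K. \<Prod>i\<in>T. a (\<phi> i)) = 0"
      by (simp add: sum_coordinate_monomial)
  qed
  finally show ?thesis .
qed

text \<open>In the expansion over the set \<open>X\<close> of factors that contribute their linear
  part, only \<open>X = T\<close> survives: a proper subset has fewer than
  \<open>k * (s - 1)\<close> elements.\<close>

lemma sum_prod_affine_diff:
  assumes V: "subsp V" "card V = s ^ k" and T: "finite T" "card T \<le> k * (s - 1)"
    and f: "\<And>i. i \<in> T \<Longrightarrow> lin V (f i)"
  shows "(\<Sum>v\<in>V. \<Prod>i\<in>T. f i v + c i) = (\<Sum>v\<in>V. \<Prod>i\<in>T. f i v)"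
proof -
  have "(\<Sum>v\<in>V. \<Prod>i\<in>T. f i v + c i)
    = (\<Sum>X\<in>Pow T. (\<Sum>v\<in>V. \<Prod>i\<in>X. f i v) * (\<Prod>i\<in>T - X. c i))"
    by (simp add: prod_add[OF T(1)] sum.swap[of _ _ V] sum_distrib_right)
  also have "\<dots> = (\<Sum>X\<in>{T}. (\<Sum>v\<in>V. \<Prod>i\<in>X. f i v) * (\<Prod>i\<in>T - X. c i))"
  proof (rule sum.mono_neutral_right)
    show "\<forall>X\<in>Pow T - {T}. (\<Sum>v\<in>V. \<Prod>i\<in>X. f i v) * (\<Prod>i\<in>T - X. c i) = 0"
    proof
      fix X assume X: "X \<in> Pow T - {T}"
      hence "card X < card T" using T(1) by (auto intro: psubset_card_mono)
      hence "(\<Sum>v\<in>V. \<Prod>i\<in>X. f i v) = 0"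
        using X T f by (intro sum_prod_linear_0[OF V]) (auto intro: finite_subset)
      thus "(\<Sum>v\<in>V. \<Prod>i\<in>X. f i v) * (\<Prod>i\<in>T - X. c i) = 0" by simp
    qed
  qed (use T in auto)
  finally show ?thesis by simp
qed

end

subsection \<open>Words of minimum weight\<close>

lemma wtq_Suc: "wtq q (Suc n) u = u mod q + wtq q n (u div q)"
  by (simp add: wtq_def qdigit_def sum.lessThan_Suc_shift div_mult2_eq del: sum.lessThan_Suc)

lemma wtq_0 [simp]: "wtq q 0 u = 0" "wtq q n 0 = 0"
  by (simp_all add: wtq_def qdigit_def)

lemma wtq_1: "q \<ge> 2 \<Longrightarrow> 0 < n \<Longrightarrow> wtq q n 1 = 1"
  by (cases n) (auto simp: wtq_Suc)

lemma wtq_add: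
  "q > 0 \<Longrightarrow> wtq q (k + j) u = wtq q k (u mod q ^ k) + wtq q j (u div q ^ k)"
proof (induction k arbitrary: u)
  case (Suc k)
  have "u mod q ^ Suc k = q * (u div q mod q ^ k) + u mod q"
    by (simp add: mod_mult2_eq)
  thus ?case using Suc by (simp add: wtq_Suc div_mult2_eq)
qed simp

lemma wtq_le:
  assumes "q > 0"
  shows "wtq q n u \<le> n * (q - 1)"
proof -
  have "u mod q \<le> q - 1" for u
    using mod_less_divisor[OF assms, of u] by linarith
  thus ?thesis
    by (induction n arbitrary: u) (simp_all add: wtq_Suc add_mono)
qed

lemma wtq_max:
  assumes "q > 0" "u < q ^ k" "wtq q k u \<ge> k * (q - 1)"
  shows "u + 1 = q ^ k"
  using assms(2,3)
proof (induction k arbitrary: u)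
  case (Suc k)
  have m: "u mod q < q" using assms(1) by simp
  have d: "u div q < q ^ k"
    using Suc.prems(1) by (simp add: less_mult_imp_div_less mult.commute)
  have le: "wtq q k (u div q) \<le> k * (q - 1)" using wtq_le[OF assms(1)] .
  have *: "u mod q + wtq q k (u div q) \<ge> (q - 1) + k * (q - 1)"
    using Suc.prems(2) by (simp add: wtq_Suc)
  hence "u mod q = q - 1" using m le by linarith
  moreover have "u div q + 1 = q ^ k" using Suc.IH[OF d] * m by linarith
  ultimately have "q * (u div q) + u mod q + 1 = q * q ^ k"
    using assms(1) by (metis Suc_eq_plus1 Suc_pred' add.assoc add_mult_distrib2 mult.right_neutral)
  thus ?case by simp
qed simp

text \<open>At most one digit falls short of \<open>q - 1\<close>, and only by one; \<open>i\<close>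
  is its position.\<close>

lemma wtq_almost_max:
  assumes "q > 0" "u < q ^ k" "wtq q k u + 1 \<ge> k * (q - 1)"
  shows "u + 1 = q ^ k \<or> (\<exists>i<k. u + 1 + q ^ i = q ^ k)"
  using assms(2,3)
proof (induction k arbitrary: u)
  case (Suc k)
  have m: "u mod q < q" using assms(1) by simp
  have d: "u div q < q ^ k"
    using Suc.prems(1) by (simp add: less_mult_imp_div_less mult.commute)
  have le: "wtq q k (u div q) \<le> k * (q - 1)" using wtq_le[OF assms(1)] .
  have *: "u mod q + wtq q k (u div q) + 1 \<ge> (q - 1) + k * (q - 1)"
    using Suc.prems(2) by (simp add: wtq_Suc)
  have u: "u = q * (u div q) + u mod q" by simp
  consider "u mod q + 1 = q" | "u mod q + 2 = q" using * le m by linarith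
  thus ?case
  proof cases
    case 1
    have "u + 1 = q * (u div q) + (u mod q + 1)" by simp
    hence eq: "u + 1 = q * (u div q + 1)" unfolding 1 by simp
    have "wtq q k (u div q) + 1 \<ge> k * (q - 1)" using * 1 by linarith
    from Suc.IH[OF d this] show ?thesis
    proof
      assume "\<exists>i<k. u div q + 1 + q ^ i = q ^ k"
      then obtain i where i: "i < k" "u div q + 1 + q ^ i = q ^ k" by blast
      have "u + 1 + q ^ Suc i = q * (u div q + 1 + q ^ i)"
        using eq by (simp add: algebra_simps)
      also have "\<dots> = q ^ Suc k" unfolding i(2) by simp
      finally show ?thesis using i(1) by (intro disjI2 exI[of _ "Suc i"]) simp
    qed (use eq in simp)
  next
    case 2
    have "wtq q k (u div q) \<ge> k * (q - 1)" using * 2 by linarith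
    from wtq_max[OF assms(1) d this] have "q * (u div q + 1) = q ^ Suc k" by simp
    moreover have "u + 1 + 1 = q * (u div q) + (u mod q + 2)" by simp
    hence "u + 1 + 1 = q * (u div q + 1)" unfolding 2 by simp
    ultimately have "u + 1 + q ^ 0 = q ^ Suc k" by simp
    thus ?thesis by blast
  qed
qed simp

lemma wtq_small:
  assumes "q \<ge> 2" "k \<le> n" "u + 1 < q ^ k"
  shows "wtq q n u < k * (q - 1)"
proof (rule ccontr)
  assume n: "\<not> ?thesis"
  have "wtq q n u = wtq q k u"
    using wtq_add[of q k "n - k" u] assms by simp
  with wtq_max[of q u k] n assms show False by auto
qed

text \<open>Since \<open>q ^ k - 1 + a = q ^ k + (a - 1)\<close>, the digit at position
  \<open>k\<close> adds one to the weight of \<open>a - 1\<close>. A larger weight would make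
  \<open>a - 1\<close> almost maximal, which the conditions on \<open>a\<close> exclude.\<close>

lemma wtq_medium:
  assumes "q \<ge> 2" "k < n" "0 < a" "a < q ^ k" "\<forall>i<k. a + q ^ i \<noteq> q ^ k"
  shows "wtq q n (q ^ k - 1 + a) < k * (q - 1)"
proof (rule ccontr)
  assume n: "\<not> ?thesis"
  obtain b where b: "a = Suc b" using assms(3) by (cases a) auto
  have "q ^ k - 1 + a = q ^ k + b" using b assms(1) by simp
  moreover have "wtq q n (q ^ k + b) = wtq q k b + 1"
    using wtq_add[of q k "n - k" "q ^ k + b"] wtq_1[of q "n - k"] assms b by simp
  ultimately have "wtq q k b + 1 \<ge> k * (q - 1)" using n by simp
  from wtq_almost_max[OF _ _ this] show False using assms b by auto
qed

section \<open>Power sums and the locator polynomial\<close>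

lemma sum_times_poly:
  fixes x :: "'a::{field,finite} \<Rightarrow> 'a"
  shows "(\<Sum>g\<in>UNIV. x g * g ^ u * poly P g) = (\<Sum>j\<le>degree P. coeff P j * (\<Sum>g\<in>UNIV. x g * g ^ (u + j)))"
proof -
  have "(\<Sum>g\<in>UNIV. x g * g ^ u * poly P g)
    = (\<Sum>g\<in>UNIV. \<Sum>j\<le>degree P. coeff P j * (x g * g ^ (u + j)))"
    by (simp add: poly_altdef sum_distrib_left power_add ac_simps)
  also have "\<dots> = (\<Sum>j\<le>degree P. \<Sum>g\<in>UNIV. coeff P j * (x g * g ^ (u + j)))"
    by (rule sum.swap)
  finally show ?thesis by (simp add: sum_distrib_left)
qed

definition root_poly :: "'a::field set \<Rightarrow> 'a poly" where
  "root_poly S = (\<Prod>g\<in>S. [:- g, 1:])"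

lemma poly_root_poly: "poly (root_poly S) x = (\<Prod>g\<in>S. x - g)"
  by (simp add: root_poly_def poly_prod)

lemma degree_root_poly: "degree (root_poly S) = card S"
  unfolding root_poly_def by (subst degree_prod_eq_sum_degree) auto

lemma lead_coeff_root_poly: "coeff (root_poly S) (card S) = 1"
proof -
  have "lead_coeff (root_poly S) = 1"
    unfolding root_poly_def lead_coeff_prod by simp
  thus ?thesis by (simp add: degree_root_poly)
qed

context finite_subfield
begin

lemma linearized_linear:
  "lin V (\<lambda>v. \<Sum>i\<in>A. c i * v ^ (s ^ i))"
  by (auto simp: linear_over_def pow_s_add distrib_left sum.distrib power_mult_distrib K_pow
      sum_distrib_left ac_simps)

lemma subsp_kernel:
  assumes "lin UNIV f"
  shows "subsp {v. f v = 0}"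
proof -
  have "f 0 = 0" using assms K_zero unfolding linear_over_def by (metis mult_zero_left UNIV_I)
  thus ?thesis using assms by (auto simp: is_subspace_over_def linear_over_def)
qed

section \<open>The BCH bound and the words that attain it\<close>

context
  fixes n k :: nat and x :: "'a \<Rightarrow> 'a"
  assumes card_field: "card (UNIV :: 'a set) = s ^ n"
    and k: "0 < k" "k \<le> n"
    and x_nonzero: "x \<noteq> (\<lambda>_. 0)"
    and low: "\<And>u. u \<le> s ^ n - 1 \<Longrightarrow> wtq s n u < k * (s - 1) \<Longrightarrow> (\<Sum>g\<in>UNIV. x g * g ^ u) = 0"
begin

text \<open>As \<open>0 ^ 0 = 1\<close>, the coordinate at 0 enters \<open>M 0\<close> and no other
  power sum.\<close>

private definition "M u = (\<Sum>g\<in>UNIV. x g * g ^ u)"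
private definition "S = {g. x g \<noteq> 0}"

private lemma sk: "s ^ k \<ge> 2" "s ^ k \<le> s ^ n"
proof -
  have "s ^ 1 \<le> s ^ k" using s_ge_2 k by (intro power_increasing) auto
  thus "s ^ k \<ge> 2" using s_ge_2 by simp
  show "s ^ k \<le> s ^ n" using s_ge_2 k by (intro power_increasing) auto
qed

private lemma M_small: "u < s ^ k - 1 \<Longrightarrow> M u = 0"
  unfolding M_def using sk s_ge_2 k by (intro low wtq_small) linarith+

private lemma M_medium:
  assumes "k < n" "0 < a" "a < s ^ k" "\<forall>i<k. a + s ^ i \<noteq> s ^ k"
  shows "M (s ^ k - 1 + a) = 0"
  unfolding M_def
proof (intro low wtq_medium assms s_ge_2)
  have "2 * s ^ k \<le> s * s ^ k" using s_ge_2 by simp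
  also have "\<dots> \<le> s ^ n" using assms(1) s_ge_2 power_increasing[of "Suc k" n s] by simp
  finally show "s ^ k - 1 + a \<le> s ^ n - 1" using assms(3) by linarith
qed

text \<open>A polynomial that vanishes on the rest of the support isolates the coordinate at
  \<open>g0\<close>.\<close>

private lemma value_at:
  assumes "g0 \<in> S"
  shows "x g0 * (\<Prod>g\<in>S-{g0}. g0 - g) = (\<Sum>j\<le>card S - 1. coeff (root_poly (S - {g0})) j * M j)"
proof -
  have "(\<Sum>g\<in>UNIV. x g * poly (root_poly (S - {g0})) g)
    = (\<Sum>g\<in>{g0}. x g * poly (root_poly (S - {g0})) g)"
    by (rule sum.mono_neutral_right) (auto simp: S_def poly_root_poly)
  moreover have "degree (root_poly (S - {g0})) = card S - 1"
    using assms by (simp add: degree_root_poly)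
  ultimately show ?thesis
    using sum_times_poly[of x 0 "root_poly (S - {g0})"] by (simp add: poly_root_poly M_def)
qed

text \<open>With fewer than \<open>s ^ k\<close> support points, \<open>value_at\<close> would
  express a nonzero quantity by power sums of index below \<open>s ^ k - 1\<close>, all of which
  vanish.\<close>

lemma min_weight_ge: "hweight x \<ge> s ^ k"
proof (rule ccontr)
  assume "\<not> ?thesis"
  hence c: "card S < s ^ k" by (simp add: hweight_def S_def)
  obtain g0 where g0: "g0 \<in> S" using x_nonzero by (auto simp: S_def)
  hence "card S > 0" by (auto simp: card_gt_0_iff)
  have "M j = 0" if "j \<in> {..card S - 1}" for j
  proof (rule M_small)
    have "j \<le> card S - 1" using that by simp
    thus "j < s ^ k - 1" using c \<open>card S > 0\<close> by linarith
  qed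
  hence "(\<Sum>j\<le>card S - 1. coeff (root_poly (S - {g0})) j * M j) = 0" by simp
  with value_at[OF g0] g0 show False by (auto simp: S_def)
qed

context
  assumes wt: "hweight x = s ^ k"
begin

private lemma card_S: "card S = s ^ k"
  using wt by (simp add: S_def hweight_def)

text \<open>Of the power sums in \<open>value_at\<close> only the top one is left, with coefficient
  1. Its independence of \<open>g0\<close> later yields that \<open>x\<close> is constant on its
  support.\<close>

private lemma value_eq:
  assumes "g0 \<in> S"
  shows "x g0 * (\<Prod>g\<in>S-{g0}. g0 - g) = M (s ^ k - 1)"
proof -
  let ?P = "root_poly (S - {g0})"
  have "(\<Sum>j\<le>card S - 1. coeff ?P j * M j) = (\<Sum>j\<in>{card S - 1}. coeff ?P j * M j)"
  proof (rule sum.mono_neutral_right)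
    show "\<forall>j\<in>{..card S - 1} - {card S - 1}. coeff ?P j * M j = 0"
      by (intro ballI mult_eq_0_iff[THEN iffD2] disjI2 M_small) (simp add: card_S)
  qed auto
  also have "coeff ?P (card S - 1) = 1"
    using lead_coeff_root_poly[of "S - {g0}"] assms by simp
  hence "(\<Sum>j\<in>{card S - 1}. coeff ?P j * M j) = M (s ^ k - 1)"
    by (simp add: card_S)
  finally show ?thesis using value_at[OF assms] by simp
qed

private lemma M_top_nonzero: "M (s ^ k - 1) \<noteq> 0"
proof -
  obtain g0 where g0: "g0 \<in> S" using x_nonzero by (auto simp: S_def)
  thus ?thesis using value_eq[OF g0, symmetric] by (auto simp: S_def)
qed

text \<open>The support consists of roots of \<open>root_poly S\<close>, so \<open>x\<close> times
  this polynomial is zero everywhere.\<close>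

private lemma newton: "(\<Sum>j\<le>s ^ k. coeff (root_poly S) j * M (u + j)) = 0"
proof -
  have "(\<Sum>g\<in>UNIV. x g * g ^ u * poly (root_poly S) g) = 0"
    by (intro sum.neutral) (auto simp: poly_root_poly S_def)
  thus ?thesis
    using sum_times_poly[of x u "root_poly S"] by (simp add: M_def degree_root_poly card_S)
qed

text \<open>
  In the Newton identity for \<open>u = a - 1\<close> a nonzero summand with \<open>s ^ k - a < j\<close> would need both
  \<open>s ^ k - j\<close> and \<open>a - (s ^ k - j)\<close> to be of the form \<open>s ^ k - s ^ i\<close>; two such numbers
  already add up to at least \<open>s ^ k\<close>.
\<close>
private lemma coeff_0:
  assumes "k < n" "0 < a" "a < s ^ k" "\<forall>i<k. a + s ^ i \<noteq> s ^ k"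
  shows "coeff (root_poly S) (s ^ k - a) = 0"
  using assms(2-4)
proof (induction a rule: less_induct)
  case (less a)
  let ?c = "coeff (root_poly S)"
  have zero: "?c j * M (a - 1 + j) = 0" if j: "j \<le> s ^ k" "j \<noteq> s ^ k - a" for j
  proof -
    consider "j < s ^ k - a" | "j = s ^ k" | "s ^ k - a < j" "j < s ^ k" using j by linarith
    thus ?thesis
    proof cases
      case 1
      thus ?thesis using less.prems by (intro mult_eq_0_iff[THEN iffD2] disjI2 M_small) linarith
    next
      case 2
      have "a - 1 + j = s ^ k - 1 + a" using 2 less.prems by linarith
      thus ?thesis using M_medium[OF assms(1) less.prems] by simp
    next
      case 3
      define b where "b = s ^ k - j"
      have b: "0 < b" "b < a" "j = s ^ k - b" "a - 1 + j = s ^ k - 1 + (a - b)"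
        using 3 less.prems by (auto simp: b_def)
      show ?thesis
      proof (cases "\<forall>i<k. b + s ^ i \<noteq> s ^ k")
        case True
        thus ?thesis using less.IH[of b] b less.prems by simp
      next
        case False
        then obtain i where i: "i < k" "b + s ^ i = s ^ k" by blast
        have half: "2 * s ^ i \<le> s ^ k" if "i < k" for i
        proof -
          have "2 * s ^ i \<le> s ^ Suc i" using s_ge_2 by simp
          also have "\<dots> \<le> s ^ k" using that s_ge_2 by (intro power_increasing) auto
          finally show ?thesis .
        qed
        have "\<forall>i'<k. a - b + s ^ i' \<noteq> s ^ k"
        proof (intro allI impI notI)
          fix i' assume "i' < k" "a - b + s ^ i' = s ^ k"
          thus False using half[of i] half[of i'] i b less.prems by linarith
        qed
        hence "M (s ^ k - 1 + (a - b)) = 0"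
          using b less.prems by (intro M_medium assms) auto
        thus ?thesis using b by simp
      qed
    qed
  qed
  \<comment> \<open>The one remaining index pairs the coefficient with \<open>M (s ^ k - 1)\<close>,
    which is nonzero.\<close>
  have "0 = (\<Sum>j\<le>s ^ k. ?c j * M (a - 1 + j))" by (simp add: newton)
  also have "\<dots> = (\<Sum>j\<in>{s ^ k - a}. ?c j * M (a - 1 + j))"
    by (rule sum.mono_neutral_right) (use zero in auto)
  also have "\<dots> = ?c (s ^ k - a) * M (s ^ k - 1)"
    using less.prems by (simp add: less_imp_le_nat)
  finally show ?case using M_top_nonzero by simp
qed

text \<open>By \<open>coeff_0\<close> the locator polynomial has only a constant term and terms at
  powers of \<open>s\<close>. It is a constant plus an additive function \<open>L\<close>, so its
  roots form a coset of the kernel of \<open>L\<close>.\<close>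

private lemma support_affine: "\<exists>h V. subsp V \<and> S = (+) h ` V"
proof (cases "k < n")
  \<comment> \<open>For \<open>k = n\<close>, where \<open>coeff_0\<close> does not apply, the
    support is the whole field.\<close>
  case False
  hence "S = UNIV"
    using card_field k by (intro card_subset_eq) (auto simp: card_S)
  moreover have "subsp UNIV" by (auto simp: is_subspace_over_def)
  ultimately show ?thesis by (intro exI[of _ 0] exI[of _ UNIV]) simp
next
  case True
  let ?c = "coeff (root_poly S)"
  define L where "L v = (\<Sum>i\<in>{..k}. ?c (s ^ i) * v ^ (s ^ i))" for v
  have linL: "lin UNIV L" unfolding L_def by (rule linearized_linear)
  have inj: "inj_on (\<lambda>i. s ^ i) {..k}" using s_ge_2 by (auto intro: inj_onI)
  have poly: "poly (root_poly S) v = ?c 0 + L v" for v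
  proof -
    have "poly (root_poly S) v = (\<Sum>j\<in>{..s ^ k}. ?c j * v ^ j)"
      by (simp add: poly_altdef degree_root_poly card_S)
    also have "\<dots> = (\<Sum>j\<in>insert 0 ((\<lambda>i. s ^ i) ` {..k}). ?c j * v ^ j)"
    proof (rule sum.mono_neutral_right)
      show "insert 0 ((\<lambda>i. s ^ i) ` {..k}) \<subseteq> {..s ^ k}"
        using s_ge_2 by (auto intro!: power_increasing)
      show "\<forall>j\<in>{..s ^ k} - insert 0 ((\<lambda>i. s ^ i) ` {..k}). ?c j * v ^ j = 0"
      proof
        fix j assume j: "j \<in> {..s ^ k} - insert 0 ((\<lambda>i. s ^ i) ` {..k})"
        hence "j \<noteq> s ^ k" "0 < j" "j \<le> s ^ k" by auto
        moreover have "s ^ k - j + s ^ i \<noteq> s ^ k" if "i < k" for i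
        proof
          assume "s ^ k - j + s ^ i = s ^ k"
          hence "j = s ^ i" using \<open>j \<le> s ^ k\<close> by linarith
          thus False using j that by auto
        qed
        ultimately have "?c (s ^ k - (s ^ k - j)) = 0"
          by (intro coeff_0 True) auto
        thus "?c j * v ^ j = 0" using \<open>j \<le> s ^ k\<close> by simp
      qed
    qed simp
    also have "\<dots> = ?c 0 + L v"
      using s_ge_2 inj by (subst sum.insert) (auto simp: sum.reindex L_def)
    finally show ?thesis .
  qed
  have S_iff: "g \<in> S \<longleftrightarrow> ?c 0 + L g = 0" for g
    unfolding poly[symmetric] poly_root_poly by (auto simp: S_def)
  obtain h where h: "h \<in> S" using x_nonzero by (auto simp: S_def)
  have add: "L (v + w) = L v + L w" for v w using linL by (simp add: linear_over_def)
  have "S = (+) h ` {v. L v = 0}"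
  proof (intro subset_antisym subsetI)
    fix g assume "g \<in> S"
    hence "?c 0 + L g = 0" "?c 0 + L h = 0" using h by (simp_all only: S_iff)
    hence "L g = L h" by (metis add_left_cancel)
    hence "L (g - h) = 0" using add[of "g - h" h] by simp
    thus "g \<in> (+) h ` {v. L v = 0}" by (intro image_eqI[of _ _ "g - h"]) auto
  next
    fix g assume "g \<in> (+) h ` {v. L v = 0}"
    thus "g \<in> S" using h by (auto simp: S_iff add)
  qed
  thus ?thesis using subsp_kernel[OF linL] by blast
qed

text \<open>For every \<open>g0\<close> in the support the differences \<open>g0 - g\<close> run
  through the nonzero elements of \<open>V\<close>, so the product in \<open>value_eq\<close> is the
  same everywhere.\<close>

lemma min_weight_word_flat:
  "\<exists>c h V. c \<noteq> 0 \<and> subsp V \<and> card V = s ^ k \<and> x = (\<lambda>g. if g \<in> (+) h ` V then c else 0)"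
proof -
  obtain h V where V: "subsp V" "S = (+) h ` V" using support_affine by blast
  have "card V = s ^ k" using card_S V(2) by (simp add: card_image)
  define c where "c = M (s ^ k - 1) / (\<Prod>v\<in>V-{0}. v)"
  have nz: "(\<Prod>v\<in>V-{0}. v) \<noteq> 0" by simp
  have "x g0 = c" if g0: "g0 \<in> S" for g0
  proof -
    obtain v0 where v0: "v0 \<in> V" "g0 = h + v0" using V(2) g0 by auto
    have "(\<Prod>g\<in>S-{g0}. g0 - g) = (\<Prod>v\<in>V-{0}. v)"
    proof (rule prod.reindex_bij_witness[of _ "\<lambda>v. g0 - v" "\<lambda>g. g0 - g"])
      fix g assume "g \<in> S - {g0}"
      thus "g0 - g \<in> V - {0}" using V v0 by (auto intro: subsp_diff)
    next
      fix v assume v: "v \<in> V - {0}"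
      have "h + (v0 - v) \<in> S" unfolding V(2) using subsp_diff[OF V(1), of v0 v] v v0 by blast
      thus "g0 - v \<in> S - {g0}" using v v0 by (auto simp: add_diff_eq)
    qed auto
    thus ?thesis using value_eq[OF g0] nz by (simp add: c_def field_simps)
  qed
  hence "x = (\<lambda>g. if g \<in> (+) h ` V then c else 0)"
    unfolding V(2)[symmetric] by (auto simp: S_def)
  moreover have "c \<noteq> 0" using M_top_nonzero nz by (simp add: c_def)
  ultimately show ?thesis using V(1) \<open>card V = s ^ k\<close> by blast
qed

end
end
end

subsection \<open>Power sums over flats\<close>

lemma sum_fun_apply: "(\<Sum>a\<in>A. f a) x = (\<Sum>a\<in>A. (f a x :: 'b::comm_monoid_add))"
  by (induction A rule: infinite_finite_induct) auto

text \<open>The point indicators form a basis. Scalars come from the whole field, so the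
  \<open>K\<close>-linear functions on a subspace form a space over the large field.\<close>

global_interpretation fun_space: finite_dimensional_vector_space
  "\<lambda>(c::'a::{field,finite}) (f :: 'a \<Rightarrow> 'a) x. c * f x"
  "range (\<lambda>a x. if x = a then 1 else 0 :: 'a)"
  defines fun_span = fun_space.span and fun_dim = fun_space.dim
    and fun_subspace = fun_space.subspace and fun_dependent = fun_space.dependent
proof -
  let ?scale = "\<lambda>(c::'a) (f :: 'a \<Rightarrow> 'a) x. c * f x"
  let ?d = "\<lambda>(a::'a) x. if x = a then 1 else 0 :: 'a"
  interpret vector_space ?scale
    by standard (auto simp: fun_eq_iff distrib_left distrib_right)
  show "finite_dimensional_vector_space ?scale (range ?d)"
  proof
    show "\<not> dependent (range ?d)"
    proof
      assume "dependent (range ?d)"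
      then obtain c v where c: "(\<Sum>a\<in>range ?d. ?scale (c a) a) = 0" "v \<in> range ?d" "c v \<noteq> 0"
        using dependent_finite[of "range ?d"] by auto
      obtain a where a: "v = ?d a" using c(2) by auto
      have "inj ?d" by (auto simp: inj_def fun_eq_iff split: if_splits)
      hence "(\<Sum>b\<in>UNIV. ?scale (c (?d b)) (?d b)) = 0"
        using c(1) by (simp add: sum.reindex)
      hence "(\<Sum>b\<in>UNIV. ?scale (c (?d b)) (?d b)) a = 0" by (simp only: zero_fun_apply)
      hence "(\<Sum>b\<in>UNIV. c (?d b) * ?d b a) = 0" by (simp only: sum_fun_apply)
      thus False using a c(3) by (simp add: if_distrib[of "\<lambda>x. _ * x"] cong: if_cong)
    qed
    show "span (range ?d) = UNIV"
    proof (intro equalityI subsetI UNIV_I)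
      fix f :: "'a \<Rightarrow> 'a"
      have "f = (\<Sum>a\<in>UNIV. ?scale (f a) (?d a))"
        by (rule ext) (simp add: sum_fun_apply if_distrib[of "\<lambda>x. _ * x"] cong: if_cong)
      also have "\<dots> \<in> span (range ?d)"
        by (intro span_sum span_scale span_base) auto
      finally show "f \<in> span (range ?d)" .
    qed
  qed simp
qed

section \<open>Digits of exponents and their even and odd sums\<close>

lemma digits_sum: "q > 0 \<Longrightarrow> u < q ^ n \<Longrightarrow> u = (\<Sum>i<n. qdigit q i u * q ^ i)"
proof (induction n arbitrary: u)
  case (Suc n)
  have "u div q < q ^ n"
    using Suc.prems by (simp add: less_mult_imp_div_less mult.commute)
  from Suc.IH[OF Suc.prems(1) this]
  have "u div q = (\<Sum>i<n. qdigit q (Suc i) u * q ^ i)"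
    by (simp add: qdigit_def div_mult2_eq)
  hence "q * (u div q) + u mod q = (\<Sum>i<Suc n. qdigit q i u * q ^ i)"
    by (simp add: sum.lessThan_Suc_shift sum_distrib_left qdigit_def ac_simps del: sum.lessThan_Suc)
  thus ?case by simp
qed simp

lemma digits_sum_less:
  assumes "\<And>j. j < n \<Longrightarrow> e j < q"
  shows "(\<Sum>j<n. e j * q ^ j) < (q::nat) ^ n"
  using assms
proof (induction n)
  case (Suc n)
  have "(\<Sum>j<Suc n. e j * q ^ j) < q ^ n + e n * q ^ n" using Suc by simp
  also have "\<dots> = (e n + 1) * q ^ n" by simp
  also have "\<dots> \<le> q * q ^ n" using Suc.prems[of n] by (intro mult_right_mono) auto
  finally show ?case by simp
qed simp

lemma qdigit_sum:
  assumes "\<And>j. j < n \<Longrightarrow> e j < q" "i < n"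
  shows "qdigit q i (\<Sum>j<n. e j * q ^ j) = e i"
  using assms
proof (induction n arbitrary: e i)
  case (Suc n)
  have q: "q > 0" using Suc.prems(1)[of 0] by simp
  have eq: "(\<Sum>j<Suc n. e j * q ^ j) = e 0 + q * (\<Sum>j<n. e (Suc j) * q ^ j)"
    by (simp add: sum.lessThan_Suc_shift sum_distrib_left ac_simps del: sum.lessThan_Suc)
  show ?case
  proof (cases i)
    case 0
    thus ?thesis using Suc.prems(1)[of 0] by (simp add: eq qdigit_def del: sum.lessThan_Suc)
  next
    case (Suc i')
    have "(\<Sum>j<Suc n. e j * q ^ j) div q = (\<Sum>j<n. e (Suc j) * q ^ j)"
      unfolding eq using Suc.prems(1)[of 0] q by simp
    thus ?thesis
      using Suc.IH[of "\<lambda>j. e (Suc j)" i'] Suc Suc.prems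
      by (simp add: qdigit_def div_mult2_eq del: sum.lessThan_Suc)
  qed
qed simp

lemma Eq_alt: "Eq q n u = (\<Sum>i<n. if even i then qdigit q i u else 0)"
  unfolding Eq_def by (subst sum.inter_filter[symmetric]) (auto intro: sum.cong)

lemma Oq_alt: "Oq q n u = (\<Sum>i<n. if odd i then qdigit q i u else 0)"
  unfolding Oq_def by (subst sum.inter_filter[symmetric]) (auto intro: sum.cong)

lemma wtq_eq_Eq_plus_Oq: "wtq q n u = Eq q n u + Oq q n u"
  unfolding wtq_def Eq_alt Oq_alt sum.distrib[symmetric] by (intro sum.cong) auto

text \<open>The right-hand sides count factors affine over F_{q^2} in \<open>g ^ u\<close> and in
  its \<open>q\<close>-th power. The Frobenius power at an odd position is a \<open>q\<close>-th
  power of such a factor, hence the weight \<open>q\<close>; one more \<open>q\<close>-th power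
  exchanges the parities.\<close>

lemma Eq_Oq_weighted_sums:
  "Eq q n u + q * Oq q n u = (\<Sum>i<n. if even i then qdigit q i u else q * qdigit q i u)"
  "q * Eq q n u + Oq q n u = (\<Sum>i<n. if odd i then qdigit q i u else q * qdigit q i u)"
  unfolding Eq_alt Oq_alt sum_distrib_left sum.distrib[symmetric] by (intro sum.cong; auto)+

lemma power_digits:
  assumes "q > 0" "u < q ^ n"
  shows "(g :: 'a::comm_semiring_1) ^ u = (\<Prod>i<n. (g ^ (q ^ i)) ^ qdigit q i u)"
proof -
  have "g ^ u = g ^ (\<Sum>i<n. qdigit q i u * q ^ i)" using digits_sum[OF assms] by simp
  also have "\<dots> = (\<Prod>i<n. (g ^ (q ^ i)) ^ qdigit q i u)"
    by (simp add: power_sum mult.commute flip: power_mult)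
  finally show ?thesis .
qed

text \<open>Here \<open>P = q - 1\<close>, so \<open>P * (P + 2) = q ^ 2 - 1\<close>. Adding the
  last two inequalities bounds \<open>E + R\<close> from below by \<open>2 * d * P\<close>, so
  equality holds; subtracting it from each leaves \<open>d * P \<le> R\<close> and
  \<open>d * P \<le> E\<close>.\<close>

lemma balanced_digits:
  fixes P E R d :: nat
  assumes "P > 0" "E + R \<le> 2 * d * P"
    and "d * (P * (P + 2)) \<le> E + (P + 1) * R" "d * (P * (P + 2)) \<le> (P + 1) * E + R"
  shows "E = d * P \<and> R = d * P"
proof -
  have "(P + 2) * (2 * d * P) \<le> (P + 2) * (E + R)"
    using assms(3,4) by (simp add: algebra_simps)
  hence "2 * d * P \<le> E + R" by (simp only: mult_le_cancel1)
  hence "E + R = 2 * d * P" using assms(2) by simp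
  moreover have "d * (P * (P + 2)) = P * (d * P) + 2 * d * P"
    "E + (P + 1) * R = P * R + (E + R)" "(P + 1) * E + R = P * E + (E + R)"
    by (simp_all add: algebra_simps)
  ultimately have "P * (d * P) \<le> P * R" "P * (d * P) \<le> P * E"
    using assms(3,4) by linarith+
  hence "d * P \<le> R" "d * P \<le> E" using assms(1) by simp_all
  thus ?thesis using \<open>E + R = 2 * d * P\<close> by simp
qed

text \<open>Splits off from \<open>q ^ i\<close> the largest power of \<open>q ^ 2\<close>; a
  leftover \<open>q\<close> goes into the exponent. In the second equation the extra
  \<open>q\<close>-th power is absorbed when \<open>i\<close> is odd.\<close>

lemma power_even_odd:
  fixes g :: "'a::comm_monoid_mult"
  shows "(g ^ q ^ i) ^ d = (g ^ ((q\<^sup>2) ^ (i div 2))) ^ (if even i then d else q * d)" (is ?thesis1)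
    and "((g ^ q ^ i) ^ d) ^ q = (g ^ ((q\<^sup>2) ^ (Suc i div 2))) ^ (if odd i then d else q * d)"
      (is ?thesis2)
proof -
  have "q ^ i * d = (q\<^sup>2) ^ (i div 2) * (if even i then d else q * d)"
    unfolding power_mult[symmetric] by (cases "even i") (auto elim!: evenE oddE)
  thus ?thesis1 by (simp only: power_mult[symmetric])
  have "q ^ i * d * q = (q\<^sup>2) ^ (Suc i div 2) * (if odd i then d else q * d)"
    unfolding power_mult[symmetric] by (cases "even i") (auto elim!: evenE oddE)
  thus ?thesis2 by (simp only: power_mult[symmetric])
qed

section \<open>Vanishing of power sums over flats\<close>

context finite_subfield
begin

text \<open>A pair \<open>(i, j)\<close> with \<open>j < e i\<close> indexes a copy of a factor, so
  the lemmas that count factors apply to products of powers.\<close>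

lemma prod_Sigma_power:
  "finite A \<Longrightarrow> (\<Prod>x\<in>(SIGMA i:A. {..<e i}). g (fst x)) = (\<Prod>i\<in>A. (g i :: 'a) ^ e i)"
  using prod.Sigma[of A "\<lambda>i. {..<e i}" "\<lambda>i j. g i"] by (simp add: case_prod_unfold)

lemma sum_prod_affine_power_diff:
  assumes V: "subsp V" "card V = s ^ k" and A: "finite A" "(\<Sum>i\<in>A. e i) \<le> k * (s - 1)"
    and f: "\<And>i. i \<in> A \<Longrightarrow> lin V (f i)"
  shows "(\<Sum>v\<in>V. \<Prod>i\<in>A. (f i v + c i) ^ e i) = (\<Sum>v\<in>V. \<Prod>i\<in>A. f i v ^ e i)"
  using sum_prod_affine_diff[OF V, of "SIGMA i:A. {..<e i}" "\<lambda>x. f (fst x)" "\<lambda>x. c (fst x)"] A f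
  unfolding prod_Sigma_power[OF A(1), where g = "\<lambda>i. f i _"]
    prod_Sigma_power[OF A(1), where g = "\<lambda>i. f i _ + c i"]
  by (auto simp: card_SigmaI)

lemma sum_prod_linear_power_0:
  assumes V: "subsp V" "card V = s ^ k" and A: "finite A" "(\<Sum>i\<in>A. e i) < k * (s - 1)"
    and f: "\<And>i. i \<in> A \<Longrightarrow> lin V (f i)"
  shows "(\<Sum>v\<in>V. \<Prod>i\<in>A. f i v ^ e i) = 0"
  using sum_prod_linear_0[OF V, of "SIGMA i:A. {..<e i}" "\<lambda>x. f (fst x)"] A f
  unfolding prod_Sigma_power[OF A(1), where g = "\<lambda>i. f i _"]
  by (auto simp: card_SigmaI)

lemma lin_power: "lin V f \<Longrightarrow> lin V (\<lambda>v. f v ^ (s ^ i))"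
  by (auto simp: linear_over_def pow_s_add power_mult_distrib K_pow)

lemma lin_monomial: "lin V (\<lambda>v. v ^ (s ^ i))"
  by (auto simp: linear_over_def pow_s_add power_mult_distrib K_pow)

text \<open>The \<open>s\<close>-th power of a linear function is again linear, so \<open>s\<close>
  copies of the factor \<open>i0\<close> merge into one, carried by the new index
  \<open>None\<close>. This lowers the number of factors below \<open>k * (s - 1)\<close>.\<close>

lemma sum_prod_overfull_0:
  assumes V: "subsp V" "card V = s ^ k" and A: "finite A" "(\<Sum>i\<in>A. e i) \<le> k * (s - 1)"
    and f: "\<And>i. i \<in> A \<Longrightarrow> lin V (f i)" and i0: "i0 \<in> A" "s \<le> e i0"
  shows "(\<Sum>v\<in>V. \<Prod>i\<in>A. f i v ^ e i) = 0"
proof -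
  define A' where "A' = insert None (Some ` A)"
  define f' where "f' = (\<lambda>i v. case i of None \<Rightarrow> f i0 v ^ s | Some i \<Rightarrow> f i v)"
  define e' where "e' = (\<lambda>i. case i of None \<Rightarrow> 1 | Some i \<Rightarrow> if i = i0 then e i - s else e i)"
  have "(\<Prod>i\<in>A. f i v ^ e i) = (\<Prod>i\<in>A'. f' i v ^ e' i)" for v
  proof -
    have "(\<Prod>i\<in>A'. f' i v ^ e' i) = f i0 v ^ s * (\<Prod>i\<in>A. f i v ^ (if i = i0 then e i - s else e i))"
      using A(1) unfolding A'_def
      by (subst prod.insert) (auto simp: prod.reindex f'_def e'_def intro!: prod.cong)
    also have "\<dots> = f i0 v ^ s * (f i0 v ^ (e i0 - s) * (\<Prod>i\<in>A-{i0}. f i v ^ e i))"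
      using A(1) i0(1) by (subst prod.remove[of _ i0]) auto
    also have "\<dots> = f i0 v ^ e i0 * (\<Prod>i\<in>A-{i0}. f i v ^ e i)"
      using i0(2) by (simp flip: mult.assoc power_add)
    also have "\<dots> = (\<Prod>i\<in>A. f i v ^ e i)" using A(1) i0(1) by (subst prod.remove[of _ i0]) auto
    finally show ?thesis ..
  qed
  moreover have "(\<Sum>v\<in>V. \<Prod>i\<in>A'. f' i v ^ e' i) = 0"
  proof (rule sum_prod_linear_power_0[OF V])
    have "(\<Sum>i\<in>A'. e' i) = 1 + (\<Sum>i\<in>A. if i = i0 then e i - s else e i)"
      using A(1) unfolding A'_def by (subst sum.insert) (auto simp: sum.reindex e'_def)
    also have "\<dots> = 1 + (e i0 - s + (\<Sum>i\<in>A-{i0}. e i))"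
      using A(1) i0(1) by (subst sum.remove[of _ i0]) auto
    also have "\<dots> < e i0 + (\<Sum>i\<in>A-{i0}. e i)" using i0(2) s_ge_2 by simp
    also have "\<dots> = (\<Sum>i\<in>A. e i)" using A(1) i0(1) by (subst (2) sum.remove[of _ i0]) auto
    finally show "(\<Sum>i\<in>A'. e' i) < k * (s - 1)" using A(2) by simp
    show "lin V (f' i)" if "i \<in> A'" for i
      using that f i0(1) lin_power[of V "f i0" 1] by (auto simp: A'_def f'_def)
  qed (use A in \<open>simp add: A'_def\<close>)
  ultimately show ?thesis by simp
qed

lemma sum_prod_flat_power_0:
  assumes V: "subsp V" "card V = s ^ k" and A: "finite A" "(\<Sum>i\<in>A. e i) < k * (s - 1)"
  shows "(\<Sum>v\<in>V. \<Prod>i\<in>A. ((h + v) ^ (s ^ t i)) ^ e i) = 0"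
proof -
  have "(\<Sum>v\<in>V. \<Prod>i\<in>A. ((h + v) ^ (s ^ t i)) ^ e i)
      = (\<Sum>v\<in>V. \<Prod>i\<in>A. (v ^ (s ^ t i) + h ^ (s ^ t i)) ^ e i)"
    by (simp add: pow_s_add add.commute)
  also have "\<dots> = (\<Sum>v\<in>V. \<Prod>i\<in>A. (v ^ (s ^ t i)) ^ e i)"
    using A by (intro sum_prod_affine_power_diff[OF V] lin_monomial) auto
  also have "\<dots> = 0"
    using A by (intro sum_prod_linear_power_0[OF V] lin_monomial) auto
  finally show ?thesis .
qed

text \<open>If \<open>g ^ u\<close> and its \<open>q\<close>-th power both needed at least
  \<open>d * (s - 1)\<close> factors, \<open>balanced_digits\<close> would force full weight and
  equal digit sums.\<close>

lemma sum_flat_power_0: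
  assumes V: "subsp V" "card V = s ^ d" and q: "s = q ^ 2" "q = CHAR('a) ^ l"
    and u: "u < q ^ n" and wt: "wtq q n u \<le> 2 * d * (q - 1)"
    and ne: "wtq q n u < 2 * d * (q - 1) \<or> Eq q n u \<noteq> Oq q n u"
  shows "(\<Sum>v\<in>V. (h + v) ^ u) = 0"
proof -
  have q2: "q \<ge> 2" using s_ge_2 q(1) by (cases "q \<le> 1") (auto simp: power2_eq_square le_Suc_eq)
  let ?E = "Eq q n u" and ?O = "Oq q n u"
  have "?E + q * ?O < d * (s - 1) \<or> q * ?E + ?O < d * (s - 1)"
  proof (rule ccontr)
    assume "\<not> ?thesis"
    hence n: "d * (s - 1) \<le> ?E + q * ?O" "d * (s - 1) \<le> q * ?E + ?O"
      by auto
    obtain P where P: "q = P + 1" "P > 0" using q2 by (cases q) auto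
    have s: "s - 1 = P * (P + 2)" by (simp add: q(1) P(1) power2_eq_square)
    have "?E = d * P \<and> ?O = d * P"
    proof (rule balanced_digits[OF P(2)])
      show "?E + ?O \<le> 2 * d * P" using wt by (simp add: wtq_eq_Eq_plus_Oq P(1))
    qed (use n in \<open>simp_all only: s P(1)\<close>)
    thus False using ne by (auto simp: wtq_eq_Eq_plus_Oq P(1))
  qed
  thus ?thesis
  proof
    assume 1: "?E + q * ?O < d * (s - 1)"
    have "(\<Sum>v\<in>V. (h + v) ^ u) = (\<Sum>v\<in>V. \<Prod>i<n. ((h + v) ^ (s ^ (i div 2))) ^
        (if even i then qdigit q i u else q * qdigit q i u))"
    proof (intro sum.cong refl)
      fix v
      show "(h + v) ^ u = (\<Prod>i<n. ((h + v) ^ (s ^ (i div 2))) ^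
        (if even i then qdigit q i u else q * qdigit q i u))"
        using u q2 unfolding q(1) power_even_odd(1)[symmetric] by (intro power_digits) auto
    qed
    also have "\<dots> = 0"
      using 1 unfolding Eq_Oq_weighted_sums by (intro sum_prod_flat_power_0[OF V]) auto
    finally show ?thesis .
  next
    assume 2: "q * ?E + ?O < d * (s - 1)"
    \<comment> \<open>Frobenius moves the \<open>q\<close>-th power inside, and it is enough that
      the \<open>q\<close>-th power of the sum vanishes.\<close>
    have "(\<Sum>v\<in>V. (h + v) ^ u) ^ q = (\<Sum>v\<in>V. ((h + v) ^ u) ^ q)"
      using frobenius_sum[OF q(2), of _ V 1] by simp
    also have "\<dots> = (\<Sum>v\<in>V. \<Prod>i<n. ((h + v) ^ (s ^ (Suc i div 2))) ^
        (if odd i then qdigit q i u else q * qdigit q i u))"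
    proof (intro sum.cong refl)
      fix v
      show "((h + v) ^ u) ^ q = (\<Prod>i<n. ((h + v) ^ (s ^ (Suc i div 2))) ^
        (if odd i then qdigit q i u else q * qdigit q i u))"
        using u q2 unfolding q(1) power_even_odd(2)[symmetric] prod_power_distrib[symmetric]
        by (intro arg_cong[of _ _ "\<lambda>x. x ^ q"] power_digits) auto
    qed
    also have "\<dots> = 0"
      using 2 unfolding Eq_Oq_weighted_sums by (intro sum_prod_flat_power_0[OF V]) auto
    finally show ?thesis using q2 by simp
  qed
qed

end

subsection \<open>Balanced subspaces\<close>

lemma fun_span_scale_sum:
  "(\<And>i. i \<in> A \<Longrightarrow> f i \<in> fun_span G) \<Longrightarrow> (\<lambda>v. \<Sum>i\<in>A. c i * f i v) \<in> fun_span (G :: ('a::{field,finite} \<Rightarrow> 'a) set)"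
proof -
  assume f: "\<And>i. i \<in> A \<Longrightarrow> f i \<in> fun_span G"
  have "(\<lambda>v. \<Sum>i\<in>A. c i * f i v) = (\<Sum>i\<in>A. (\<lambda>v. c i * f i v))"
    by (rule ext) (simp add: sum_fun_apply)
  also have "\<dots> \<in> fun_span G"
    by (intro fun_space.span_sum fun_space.span_scale f)
  finally show ?thesis .
qed

text \<open>The sum is linear in each factor, so generators can be replaced by span elements one
  factor at a time. The weight \<open>w\<close> stays general to absorb the generator chosen for the
  current factor.\<close>

lemma fun_span_multilinear:
  fixes V :: "'a::{field,finite} set"
  assumes "finite T"
    and "\<And>g. (\<forall>i\<in>T. g i \<in> G i) \<Longrightarrow> (\<Sum>v\<in>V. w v * (\<Prod>i\<in>T. g i v)) = 0"
    and "\<forall>i\<in>T. f i \<in> fun_span (G i)"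
  shows "(\<Sum>v\<in>V. w v * (\<Prod>i\<in>T. f i v)) = 0"
  using assms
proof (induction T arbitrary: w rule: finite_induct)
  case empty
  thus ?case by simp
next
  case (insert t T)
  let ?S = "{h. (\<Sum>v\<in>V. w v * (h v * (\<Prod>i\<in>T. f i v))) = 0}"
  have "fun_subspace ?S"
  proof (rule fun_space.subspaceI)
    fix g h assume "g \<in> ?S" "h \<in> ?S"
    thus "g + h \<in> ?S" by (simp add: distrib_left distrib_right sum.distrib)
  next
    fix c h assume "h \<in> ?S"
    hence "c * (\<Sum>v\<in>V. w v * (h v * (\<Prod>i\<in>T. f i v))) = 0" by simp
    thus "(\<lambda>x. c * h x) \<in> ?S" by (simp add: sum_distrib_left ac_simps)
  qed simp
  moreover have "G t \<subseteq> ?S"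
  proof
    fix h assume h: "h \<in> G t"
    have "(\<Sum>v\<in>V. w v * h v * (\<Prod>i\<in>T. f i v)) = 0"
    proof (rule insert.IH)
      fix g assume g: "\<forall>i\<in>T. g i \<in> G i"
      have "(\<Sum>v\<in>V. w v * (\<Prod>i\<in>insert t T. (g(t := h)) i v)) = 0"
        using g h by (intro insert.prems(1)) auto
      moreover have "(\<Prod>i\<in>T. (g(t := h)) i v) = (\<Prod>i\<in>T. g i v)" for v
        using insert.hyps(2) by (intro prod.cong) auto
      ultimately show "(\<Sum>v\<in>V. w v * h v * (\<Prod>i\<in>T. g i v)) = 0"
        using insert.hyps by (simp add: mult.assoc)
    qed (use insert.prems(2) in auto)
    thus "h \<in> ?S" by (simp add: mult.assoc)
  qed
  ultimately have "fun_span (G t) \<subseteq> ?S" by (intro fun_space.span_minimal)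
  thus ?case using insert.prems(2) insert.hyps by auto
qed

context finite_subfield
begin

section \<open>The linear functions on a subspace and the Frobenius powers that span them\<close>

context
  fixes V :: "'a set" and k :: nat
  assumes V: "subsp V" and card_V: "card V = s ^ k"
begin

text \<open>The values may lie outside \<open>K\<close>. Extension by 0 makes an element determined
  by its restriction to \<open>V\<close>.\<close>

private definition "lins = {f. lin V f \<and> (\<forall>v. v \<notin> V \<longrightarrow> f v = 0)}"

private definition "fr i = (\<lambda>v. if v \<in> V then v ^ (s ^ i) else (0::'a))"

private lemma V_add: "v \<in> V \<Longrightarrow> w \<in> V \<Longrightarrow> v + w \<in> V"
  and V_scale: "c \<in> K \<Longrightarrow> v \<in> V \<Longrightarrow> c * v \<in> V"
  using V by (auto simp: is_subspace_over_def)

private lemma subspace_lins: "fun_subspace lins"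
  by (rule fun_space.subspaceI) (auto simp: lins_def linear_over_def algebra_simps)

private lemma fr_lins: "fr i \<in> lins"
  using lin_monomial[of V i] by (auto simp: lins_def fr_def linear_over_def V_add V_scale)

text \<open>A nonzero polynomial of this form has degree at most \<open>s ^ (k - 1)\<close>, less
  than the number of points of \<open>V\<close>.\<close>

private lemma linearized_root_bound:
  assumes "\<And>v. v \<in> V \<Longrightarrow> (\<Sum>i<k. c i * v ^ (s ^ i)) = 0" "i < k"
  shows "c i = 0"
proof (rule ccontr)
  assume ci: "c i \<noteq> 0"
  define P where "P = (\<Sum>i<k. monom (c i) (s ^ i))"
  have "coeff P (s ^ i) = (\<Sum>j<k. if j = i then c j else 0)"
    unfolding P_def coeff_sum using s_ge_2 by (intro sum.cong) auto
  hence "coeff P (s ^ i) = c i" using assms(2) by simp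
  hence "P \<noteq> 0" using ci by auto
  have "V \<subseteq> {v. poly P v = 0}"
    using assms(1) by (auto simp: P_def poly_sum poly_monom)
  hence "s ^ k \<le> card {v. poly P v = 0}" unfolding card_V[symmetric] by (intro card_mono) auto
  also have "\<dots> \<le> degree P" using card_poly_roots_bound[OF \<open>P \<noteq> 0\<close>] .
  also have "\<dots> \<le> s ^ (k - 1)"
    unfolding P_def
  proof (rule degree_sum_le)
    fix j assume "j \<in> {..<k}"
    hence "s ^ j \<le> s ^ (k - 1)" using s_ge_2 by (intro power_increasing) auto
    thus "degree (monom (c j) (s ^ j)) \<le> s ^ (k - 1)" using degree_monom_le le_trans by blast
  qed simp
  also have "\<dots> < s ^ k" using s_ge_2 assms(2) by (intro power_strict_increasing) auto
  finally show False by simp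
qed

private lemma inj_fr: "inj_on fr {..<k}"
proof (rule inj_onI, rule ccontr)
  fix i j assume ij: "i \<in> {..<k}" "j \<in> {..<k}" "fr i = fr j" "i \<noteq> j"
  let ?c = "\<lambda>l. if l = i then 1 else if l = j then -1 else (0::'a)"
  have "?c i = 0"
  proof (rule linearized_root_bound[where c = "?c" and i = i])
    fix v assume "v \<in> V"
    hence eq: "v ^ (s ^ i) = v ^ (s ^ j)" using fun_cong[OF ij(3), of v] by (simp add: fr_def)
    have "(\<Sum>l<k. ?c l * v ^ (s ^ l)) = (\<Sum>l\<in>{i,j}. ?c l * v ^ (s ^ l))"
      using ij by (intro sum.mono_neutral_right) auto
    thus "(\<Sum>l<k. ?c l * v ^ (s ^ l)) = 0" using ij(4) eq by simp
  qed (use ij in auto)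
  thus False by simp
qed

private lemma independent_fr: "\<not> fun_dependent (fr ` {..<k})"
  unfolding fun_space.independent_explicit
proof (intro conjI allI impI ballI)
  fix c f assume z: "(\<Sum>f\<in>fr ` {..<k}. (\<lambda>x. c f * f x)) = 0" and f: "f \<in> fr ` {..<k}"
  obtain i where i: "i < k" "f = fr i" using f by auto
  have "c (fr i) = 0"
  proof (rule linearized_root_bound[where c = "\<lambda>i. c (fr i)"])
    fix v assume v: "v \<in> V"
    have "(\<Sum>f\<in>fr ` {..<k}. (\<lambda>x. c f * f x)) v = 0" using z by simp
    hence "(\<Sum>i<k. c (fr i) * fr i v) = 0" by (simp add: sum_fun_apply sum.reindex[OF inj_fr])
    thus "(\<Sum>i<k. c (fr i) * v ^ (s ^ i)) = 0" using v by (simp add: fr_def)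
  qed (rule i)
  thus "c f = 0" using i by simp
qed simp

text \<open>The \<open>x b\<close> form the dual basis of a \<open>K\<close>-basis \<open>B\<close>
  of \<open>V\<close>, extended by 0.\<close>

private lemma coordinate_functions:
  obtains B x where "card B = k" "indep B" "spanK B = V" "\<forall>b\<in>B. x b \<in> lins"
    "\<forall>f\<in>lins. f = (\<lambda>v. \<Sum>b\<in>B. f b * x b v)"
    "\<forall>a\<in>B \<rightarrow>\<^sub>E K. \<forall>b\<in>B. x b (\<Sum>b\<in>B. a b * b) = a b"
proof -
  obtain B where B: "B \<subseteq> V" "indep B" "spanK B = V" using basis_exists[OF V] .
  have cB: "card B = k"
    using card_span[OF B(2)] B(3) card_V s_ge_2 power_inject_exp[of s] by simp
  let ?E = "\<lambda>a. \<Sum>b\<in>B. a b * b"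
  have bij: "bij_betw ?E (B \<rightarrow>\<^sub>E K) V" using bij_coordinates[OF B(2)] B(3) by simp
  define cf where "cf = inv_into (B \<rightarrow>\<^sub>E K) ?E"
  define x where "x b v = (if v \<in> V then cf v b else 0)" for b v
  have cfE: "cf (?E a) = a" if "a \<in> B \<rightarrow>\<^sub>E K" for a
    unfolding cf_def using bij that by (intro inv_into_f_f) (auto simp: bij_betw_def)
  have E_V: "?E a \<in> V" if "a \<in> B \<rightarrow>\<^sub>E K" for a using bij that by (auto simp: bij_betw_def)
  have cf_PiE: "cf v \<in> B \<rightarrow>\<^sub>E K" and E_cf: "?E (cf v) = v" if "v \<in> V" for v
  proof -
    have "v \<in> ?E ` (B \<rightarrow>\<^sub>E K)" using bij that by (simp add: bij_betw_def)
    thus "cf v \<in> B \<rightarrow>\<^sub>E K" "?E (cf v) = v"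
      unfolding cf_def by (rule inv_into_into, rule f_inv_into_f[of v ?E])
  qed
  have xE: "x b (?E a) = a b" if "a \<in> B \<rightarrow>\<^sub>E K" for a b
    using cfE[OF that] E_V[OF that] by (simp add: x_def)
  have x_eq: "x b (?E a) = a b" if "\<And>b. b \<in> B \<Longrightarrow> a b \<in> K" "b \<in> B" for a b
  proof -
    have "?E a = ?E (restrict a B)" by (intro sum.cong) auto
    thus ?thesis using xE[of "restrict a B" b] that by auto
  qed
  have x_lins: "x b \<in> lins" if b: "b \<in> B" for b
  proof -
    have "x b (v + w) = x b v + x b w" if "v \<in> V" "w \<in> V" for v w
    proof -
      have "v + w = ?E (\<lambda>b. cf v b + cf w b)"
        using E_cf that by (simp add: distrib_right sum.distrib)
      moreover have "x b (?E (\<lambda>b. cf v b + cf w b)) = cf v b + cf w b"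
        using cf_PiE[OF that(1)] cf_PiE[OF that(2)] b by (intro x_eq K_add) auto
      ultimately show ?thesis using that by (simp add: x_def)
    qed
    moreover have "x b (c * v) = c * x b v" if "c \<in> K" "v \<in> V" for c v
    proof -
      have "c * v = ?E (\<lambda>b. c * cf v b)"
        using E_cf[OF that(2)] by (simp add: mult.assoc flip: sum_distrib_left)
      moreover have "x b (?E (\<lambda>b. c * cf v b)) = c * cf v b"
        using cf_PiE[OF that(2)] b that by (intro x_eq K_mult) auto
      ultimately show ?thesis using that by (simp add: x_def)
    qed
    ultimately show ?thesis by (auto simp: lins_def linear_over_def x_def)
  qed
  have "f = (\<lambda>v. \<Sum>b\<in>B. f b * x b v)" if f: "f \<in> lins" for f
  proof
    fix v
    show "f v = (\<Sum>b\<in>B. f b * x b v)"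
    proof (cases "v \<in> V")
      case True
      have "f v = f (?E (cf v))" using E_cf[OF True] by simp
      also have "\<dots> = (\<Sum>b\<in>B. cf v b * f b)"
        using f B(1) cf_PiE[OF True] by (intro lin_sum[OF V]) (auto simp: lins_def)
      finally show ?thesis using True by (simp add: x_def mult.commute)
    qed (use f in \<open>simp add: lins_def x_def\<close>)
  qed
  thus ?thesis using that[of B x] cB B x_lins xE by blast
qed

private lemma dim_lins: "fun_dim lins = k"
proof (rule antisym)
  obtain B x where B: "card B = k" "indep B" "spanK B = V"
      "\<forall>b\<in>B. x b \<in> lins"
    "\<forall>f\<in>lins. f = (\<lambda>v. \<Sum>b\<in>B. f b * x b v)"
    "\<forall>a\<in>B \<rightarrow>\<^sub>E K. \<forall>b\<in>B. x b (\<Sum>b\<in>B. a b * b) = a b"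
    using coordinate_functions .
  have "lins \<subseteq> fun_span (x ` B)"
  proof
    fix f assume "f \<in> lins"
    hence "f = (\<lambda>v. \<Sum>b\<in>B. f b * x b v)" using B(5) by blast
    moreover have "(\<lambda>v. \<Sum>b\<in>B. f b * x b v) \<in> fun_span (x ` B)"
      by (intro fun_span_scale_sum fun_space.span_base) auto
    ultimately show "f \<in> fun_span (x ` B)" by simp
  qed
  hence "fun_dim lins \<le> card (x ` B)" by (intro fun_space.dim_le_card) auto
  also have "\<dots> \<le> k" using card_image_le[of B x] B(1) by simp
  finally show "fun_dim lins \<le> k" .
next
  have "card (fr ` {..<k}) \<le> fun_dim lins"
    using fr_lins independent_fr by (intro fun_space.independent_card_le_dim) auto
  thus "k \<le> fun_dim lins" by (simp add: card_image[OF inj_fr])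
qed

private lemma span_fr: "fun_span (fr ` {..<k}) = lins"
proof
  show "fun_span (fr ` {..<k}) \<subseteq> lins"
    using fr_lins by (intro fun_space.span_minimal subspace_lins) auto
  show "lins \<subseteq> fun_span (fr ` {..<k})"
    using fr_lins independent_fr dim_lins
    by (intro fun_space.card_ge_dim_independent) (auto simp: card_image[OF inj_fr])
qed

text \<open>Otherwise the product of the \<open>(s - 1)\<close>-th powers of the coordinate
  functions, expanded in \<open>L\<close>, would sum to zero: a monomial of degree
  \<open>k * (s - 1)\<close> has an exponent of at least \<open>s\<close> or has all exponents equal
  to \<open>s - 1\<close>. In coordinates, however, this sum is \<open>(-1) ^ k\<close>.\<close>

private lemma sum_prod_basis_nonzero:
  assumes L: "L \<subseteq> lins" "lins \<subseteq> fun_span L" "card L = k"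
  shows "(\<Sum>v\<in>V. \<Prod>l\<in>L. l v ^ (s - 1)) \<noteq> 0"
proof
  assume z: "(\<Sum>v\<in>V. \<Prod>l\<in>L. l v ^ (s - 1)) = 0"
  obtain B x where B: "card B = k" "indep B" "spanK B = V" "\<forall>b\<in>B. x b \<in> lins"
    "\<forall>f\<in>lins. f = (\<lambda>v. \<Sum>b\<in>B. f b * x b v)"
    and xE: "\<forall>a\<in>B \<rightarrow>\<^sub>E K. \<forall>b\<in>B. x b (\<Sum>b\<in>B. a b * b) = a b"
    using coordinate_functions .
  let ?T = "SIGMA b:B. {..<s - 1}"
  have "(\<Sum>v\<in>V. 1 * (\<Prod>i\<in>?T. x (fst i) v)) = 0"
  proof (rule fun_span_multilinear[where G = "\<lambda>_. L"])
    fix g assume g: "\<forall>i\<in>?T. g i \<in> L"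
    define e where "e l = card {i\<in>?T. g i = l}" for l
    have "(\<Prod>i\<in>?T. g i v) = (\<Prod>l\<in>L. l v ^ e l)" for v
    proof -
      have "(\<Prod>l\<in>L. l v ^ e l) = (\<Prod>l\<in>L. \<Prod>i\<in>{i\<in>?T. g i = l}. g i v)"
        by (simp add: e_def)
      also have "\<dots> = (\<Prod>i\<in>?T. g i v)" using g by (intro prod.group) auto
      finally show ?thesis ..
    qed
    moreover have sum_e: "(\<Sum>l\<in>L. e l) = k * (s - 1)"
    proof -
      have "(\<Sum>l\<in>L. e l) = (\<Sum>l\<in>L. \<Sum>i\<in>{i\<in>?T. g i = l}. 1)" by (simp add: e_def)
      also have "\<dots> = (\<Sum>i\<in>?T. 1)" using g by (intro sum.group) auto
      finally show ?thesis by (simp add: B(1))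
    qed
    moreover have "(\<Sum>v\<in>V. \<Prod>l\<in>L. l v ^ e l) = 0"
    proof (cases "\<exists>l\<in>L. e l \<ge> s")
      case True
      then obtain l where "l \<in> L" "e l \<ge> s" by blast
      thus ?thesis
        using sum_prod_overfull_0[OF V card_V, of L e "\<lambda>l. l" l] sum_e L(1) by (auto simp: lins_def)
    next
      case False
      hence le: "e l \<le> s - 1" if "l \<in> L" for l using that by fastforce
      have "e l = s - 1" if l: "l \<in> L" for l
      proof (rule ccontr)
        assume "e l \<noteq> s - 1"
        hence "(\<Sum>l\<in>L. e l) < (\<Sum>l\<in>L. s - 1)"
          using le l by (intro sum_strict_mono_ex1) (auto intro!: bexI[of _ l] simp: order.strict_iff_order)
        thus False using sum_e L(3) by simp
      qed
      thus ?thesis using z by simp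
    qed
    ultimately show "(\<Sum>v\<in>V. 1 * (\<Prod>i\<in>?T. g i v)) = 0" by simp
  qed (use B L in auto)
  hence "(\<Sum>v\<in>V. \<Prod>b\<in>B. x b v ^ (s - 1)) = 0"
    by (simp add: prod_Sigma_power[where g = "\<lambda>b. x b _"])
  hence "(\<Sum>a\<in>B \<rightarrow>\<^sub>E K. \<Prod>b\<in>B. x b (\<Sum>b\<in>B. a b * b) ^ (s - 1)) = 0"
    using sum.reindex_bij_betw[OF bij_coordinates[OF B(2)], of "\<lambda>v. \<Prod>b\<in>B. x b v ^ (s - 1)"] B(3)
    by simp
  hence "(\<Sum>a\<in>B \<rightarrow>\<^sub>E K. \<Prod>b\<in>B. a b ^ (s - 1)) = 0" using xE by simp
  hence "(\<Prod>b\<in>B. \<Sum>y\<in>K. y ^ (s - 1)) = 0" by (subst (asm) sum_coordinate_monomial) auto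
  moreover have "(\<Sum>y\<in>K. y ^ (s - 1)) = - 1"
  proof -
    have "(\<Sum>y\<in>K. y ^ (s - 1)) = (\<Sum>y\<in>K. 1 - (if y = 0 then 1 else 0))"
      using s_ge_2 K_pow_minus1 by (intro sum.cong) (auto simp: power_0_left)
    also have "\<dots> = (\<Sum>y\<in>K. y ^ 0) - 1"
      using K_zero by (simp add: sum_subtractf)
    finally show ?thesis using power_sum_0[of 0] s_ge_2 by simp
  qed
  ultimately show False by simp
qed

section \<open>Even and odd Frobenius powers on a subspace\<close>

context
  fixes n d :: nat
  assumes card_field: "card (UNIV :: 'a set) = s ^ n" and n_even: "even n"
    and k_eq: "k = 2 * d" and k_le: "k \<le> n"
    and unbalanced: "\<And>u. u < s ^ n \<Longrightarrow> wtq s n u = k * (s - 1) \<Longrightarrow> Eq s n u = Oq s n u + 2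
      \<Longrightarrow> (\<Sum>v\<in>V. v ^ u) = 0"
begin

private definition "evens = fun_span (fr ` {i. i < n \<and> even i})"
private definition "odds = fun_span (fr ` {i. i < n \<and> odd i})"

text \<open>By multilinearity the factors may be taken to be Frobenius powers, even ones on
  \<open>TE\<close> and odd ones elsewhere. If one occurs at least \<open>s\<close> times, the sum
  vanishes; otherwise the multiplicities are the digits of a \<open>u\<close> to which
  \<open>unbalanced\<close> applies.\<close>

private lemma sum_prod_unbalanced_0:
  assumes T: "finite T" "TE \<subseteq> T" "card T = k * (s - 1)" "card TE = card (T - TE) + 2"
    and f: "\<And>i. i \<in> TE \<Longrightarrow> f i \<in> evens" "\<And>i. i \<in> T - TE \<Longrightarrow> f i \<in> odds"
  shows "(\<Sum>v\<in>V. \<Prod>i\<in>T. f i v) = 0"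
proof -
  let ?G = "\<lambda>i. fr ` {j. j < n \<and> (even j \<longleftrightarrow> i \<in> TE)}"
  have "(\<Sum>v\<in>V. 1 * (\<Prod>i\<in>T. f i v)) = 0"
  proof (rule fun_span_multilinear[where G = ?G])
    show "\<forall>i\<in>T. f i \<in> fun_span (?G i)"
    proof
      fix i assume "i \<in> T"
      thus "f i \<in> fun_span (?G i)"
        using f[of i] by (cases "i \<in> TE") (simp_all add: evens_def odds_def)
    qed
  next
    fix g assume "\<forall>i\<in>T. g i \<in> ?G i"
    hence "\<forall>i\<in>T. \<exists>j. j < n \<and> (even j \<longleftrightarrow> i \<in> TE) \<and> g i = fr j" by blast
    then obtain \<phi> where \<phi>: "\<forall>i\<in>T. \<phi> i < n \<and> (even (\<phi> i) \<longleftrightarrow> i \<in> TE) \<and> g i = fr (\<phi> i)"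
      by (metis bchoice)
    define e where "e j = card {i\<in>T. \<phi> i = j}" for j
    have "(\<Sum>v\<in>V. \<Prod>i\<in>T. g i v) = (\<Sum>v\<in>V. \<Prod>j<n. (v ^ (s ^ j)) ^ e j)"
    proof (intro sum.cong refl)
      fix v assume v: "v \<in> V"
      have "(\<Prod>i\<in>T. g i v) = (\<Prod>i\<in>T. v ^ (s ^ \<phi> i))"
        using \<phi> v by (intro prod.cong) (auto simp: fr_def)
      also have "\<dots> = (\<Prod>j<n. \<Prod>i\<in>{i\<in>T. \<phi> i = j}. v ^ (s ^ \<phi> i))"
        using \<phi> T(1) by (intro prod.group[symmetric]) auto
      also have "\<dots> = (\<Prod>j<n. (v ^ (s ^ j)) ^ e j)" by (simp add: e_def)
      finally show "(\<Prod>i\<in>T. g i v) = (\<Prod>j<n. (v ^ (s ^ j)) ^ e j)" .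
    qed
    also have "\<dots> = 0"
    proof -
      have "(\<Sum>j<n. e j) = (\<Sum>j<n. \<Sum>i\<in>{i\<in>T. \<phi> i = j}. 1)" by (simp add: e_def)
      also have "\<dots> = (\<Sum>i\<in>T. 1)" using \<phi> T(1) by (intro sum.group) auto
      finally have sum_e: "(\<Sum>j<n. e j) = k * (s - 1)" using T(3) by simp
      show ?thesis
      proof (cases "\<exists>j<n. e j \<ge> s")
        case True
        then obtain j where "j < n" "e j \<ge> s" by blast
        thus ?thesis
          using sum_e by (intro sum_prod_overfull_0[OF V card_V, of _ _ _ j] lin_monomial) auto
      next
        case False
        hence less: "e j < s" if "j < n" for j using that by (meson not_le)
        define u where "u = (\<Sum>j<n. e j * s ^ j)"
        have digit: "qdigit s j u = e j" if "j < n" for j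
          unfolding u_def using less that by (intro qdigit_sum) auto
        have u: "u < s ^ n" unfolding u_def using less by (intro digits_sum_less)
        have wt: "wtq s n u = k * (s - 1)"
          unfolding wtq_def sum_e[symmetric] by (intro sum.cong) (auto simp: digit)
        have "Eq s n u = (\<Sum>j<n. \<Sum>i\<in>{i\<in>TE. \<phi> i = j}. 1)"
          unfolding Eq_alt
        proof (intro sum.cong refl)
          fix j assume j: "j \<in> {..<n}"
          have "{i\<in>TE. \<phi> i = j} = (if even j then {i\<in>T. \<phi> i = j} else {})"
            using \<phi> T(2) by auto
          thus "(if even j then qdigit s j u else 0) = (\<Sum>i\<in>{i\<in>TE. \<phi> i = j}. 1)"
            using digit j by (simp add: e_def)
        qed
        also have "\<dots> = (\<Sum>i\<in>TE. 1)"
          using \<phi> T by (intro sum.group) (auto intro: finite_subset)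
        finally have E: "Eq s n u = card TE" by simp
        have "card T = card TE + card (T - TE)"
          using T(1,2) card_mono[OF T(1,2)] by (simp add: card_Diff_subset finite_subset)
        hence "Eq s n u = Oq s n u + 2"
          using wt E T(3,4) wtq_eq_Eq_plus_Oq[of s n u] by simp
        hence "(\<Sum>v\<in>V. v ^ u) = 0" using u wt by (intro unbalanced)
        moreover have "(\<Prod>j<n. (v ^ (s ^ j)) ^ e j) = v ^ u" for v :: 'a
          unfolding u_def by (simp add: power_sum mult.commute flip: power_mult)
        ultimately show ?thesis by simp
      qed
    qed
    finally show "(\<Sum>v\<in>V. 1 * (\<Prod>i\<in>T. g i v)) = 0" by simp
  qed (use T in auto)
  thus ?thesis by simp
qed

text \<open>Raising to the \<open>s\<close>-th power is additive and turns a scalar \<open>c\<close>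
  into \<open>c ^ s\<close>, so the functions whose \<open>s\<close>-th power lies in a given span
  form a subspace.\<close>

private lemma frobenius_span:
  assumes "\<And>i. i \<in> I \<Longrightarrow> (\<lambda>v. fr i v ^ s) \<in> fun_span G" "f \<in> fun_span (fr ` I)"
  shows "(\<lambda>v. f v ^ s) \<in> fun_span G"
proof -
  let ?S = "{f. (\<lambda>v. f v ^ s) \<in> fun_span G}"
  have "fun_subspace ?S"
  proof (rule fun_space.subspaceI)
    have "(\<lambda>v. (0 :: 'a \<Rightarrow> 'a) v ^ s) = 0" using s_ge_2 by (simp add: fun_eq_iff)
    thus "0 \<in> ?S" using fun_space.span_zero by simp
  next
    fix g h assume gh: "g \<in> ?S" "h \<in> ?S"
    have "(\<lambda>v. (g + h) v ^ s) = (\<lambda>v. g v ^ s) + (\<lambda>v. h v ^ s)"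
      using pow_s_add[where i = 1] by (simp add: fun_eq_iff)
    thus "g + h \<in> ?S" using gh fun_space.span_add by simp
  next
    fix c h assume h: "h \<in> ?S"
    have "(\<lambda>v. (c * h v) ^ s) = (\<lambda>v. c ^ s * h v ^ s)" by (simp add: power_mult_distrib)
    thus "(\<lambda>x. c * h x) \<in> ?S" using h fun_space.span_scale[of "\<lambda>v. h v ^ s" G "c ^ s"] by simp
  qed
  moreover have "fr ` I \<subseteq> ?S" using assms(1) by auto
  ultimately have "fun_span (fr ` I) \<subseteq> ?S" by (intro fun_space.span_minimal)
  thus ?thesis using assms(2) by auto
qed

private lemma frobenius_fr: "(\<lambda>v. fr i v ^ s) = fr (Suc i)"
  using s_ge_2 by (auto simp: fr_def fun_eq_iff power_0_left mult.commute simp flip: power_mult)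

private lemma fr_n: "fr n = fr 0"
  using power_card_field[where 'a = 'a] by (auto simp: fr_def card_field fun_eq_iff)

private lemma frobenius_evens: "f \<in> evens \<Longrightarrow> (\<lambda>v. f v ^ s) \<in> odds"
  unfolding evens_def odds_def
proof (erule frobenius_span[rotated])
  fix i assume i: "i \<in> {i. i < n \<and> even i}"
  hence "Suc i \<noteq> n" using n_even by auto
  hence "Suc i \<in> {i. i < n \<and> odd i}" using i by auto
  thus "(\<lambda>v. fr i v ^ s) \<in> fun_span (fr ` {i. i < n \<and> odd i})"
    unfolding frobenius_fr by (intro fun_space.span_base imageI)
qed

text \<open>As \<open>n\<close> is even, the last index \<open>n - 1\<close> is odd, and its
  successor wraps around to 0 by \<open>fr_n\<close>.\<close>

private lemma frobenius_odds: "f \<in> odds \<Longrightarrow> (\<lambda>v. f v ^ s) \<in> evens"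
  unfolding evens_def odds_def
proof (erule frobenius_span[rotated])
  fix i assume i: "i \<in> {i. i < n \<and> odd i}"
  have "fr (Suc i) \<in> fr ` {i. i < n \<and> even i}"
  proof (cases "Suc i = n")
    case True
    thus ?thesis using fr_n i by (auto intro!: imageI)
  qed (use i in auto)
  thus "(\<lambda>v. fr i v ^ s) \<in> fun_span (fr ` {i. i < n \<and> even i})"
    unfolding frobenius_fr by (intro fun_space.span_base)
qed

private lemma inj_frobenius: "x ^ s = y ^ s \<Longrightarrow> x = (y :: 'a)"
proof -
  assume eq: "x ^ s = y ^ s"
  have "(x - y) ^ s + y ^ s = x ^ s" using pow_s_add[of "x - y" y 1] by simp
  thus ?thesis using eq s_ge_2 by simp
qed

text \<open>The Frobenius map is injective and semilinear, and scalars have \<open>s\<close>-th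
  roots, so independent families stay independent.\<close>

private lemma dim_frobenius_le:
  assumes "\<And>f. f \<in> P \<Longrightarrow> (\<lambda>v. f v ^ s) \<in> Q"
  shows "fun_dim P \<le> fun_dim (Q :: ('a \<Rightarrow> 'a) set)"
proof -
  obtain L where L: "L \<subseteq> P" "\<not> fun_dependent L" "card L = fun_dim P"
    using fun_space.basis_exists by metis
  let ?F = "\<lambda>f v. f v ^ s :: 'a"
  have inj: "inj_on ?F L"
    by (intro inj_onI ext) (metis inj_frobenius)
  have "\<not> fun_dependent (?F ` L)"
    unfolding fun_space.independent_explicit
  proof (intro conjI allI impI ballI)
    fix c g assume z: "(\<Sum>f\<in>?F ` L. (\<lambda>x. c f * f x)) = 0" and g: "g \<in> ?F ` L"
    have n0: "n > 0" using card_field card_mono[of "UNIV :: 'a set" "{0,1}"] by (cases n) auto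
    \<comment> \<open>An \<open>s\<close>-th root of the coefficient, because the field has
      \<open>s * s ^ (n - 1)\<close> elements.\<close>
    define b where "b f = c (?F f) ^ (s ^ (n - 1))" for f
    have b: "b f ^ s = c (?F f)" for f
    proof -
      have "b f ^ s = c (?F f) ^ (s ^ n)"
        unfolding b_def power_mult[symmetric] using n0 by (cases n) (auto simp: mult.commute)
      thus ?thesis using power_card_field[of "c (?F f)"] by (simp add: card_field)
    qed
    have "(\<Sum>f\<in>L. (\<lambda>x. b f * f x)) = 0"
    proof
      fix v
      have "(\<Sum>f\<in>L. b f * f v) ^ s = (\<Sum>f\<in>L. (b f * f v) ^ s)"
        using s_power frobenius_sum[of s _ "\<lambda>f. b f * f v" L 1] by auto
      also have "\<dots> = (\<Sum>f\<in>L. c (?F f) * ?F f v)" by (simp add: power_mult_distrib b)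
      also have "\<dots> = (\<Sum>f\<in>?F ` L. (\<lambda>x. c f * f x)) v"
        by (simp add: sum_fun_apply sum.reindex[OF inj])
      also have "\<dots> = 0" using z by simp
      finally show "(\<Sum>f\<in>L. (\<lambda>x. b f * f x)) v = 0 v" by (simp add: sum_fun_apply)
    qed
    hence "\<forall>f\<in>L. b f = 0" using L(2) unfolding fun_space.independent_explicit by blast
    moreover obtain f where f: "f \<in> L" "g = ?F f" using g by blast
    ultimately have "b f ^ s = 0" using s_ge_2 by simp
    thus "c g = 0" unfolding b f(2) .
  qed simp
  hence "card (?F ` L) \<le> fun_dim Q"
    using L(1) assms by (intro fun_space.independent_card_le_dim) auto
  thus ?thesis using card_image[OF inj] L(3) by simp
qed

private lemma dim_evens_odds: "fun_dim evens = fun_dim odds"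
  by (rule antisym) (rule dim_frobenius_le, erule frobenius_evens, rule dim_frobenius_le, erule frobenius_odds)

private lemma evens_lins: "evens \<subseteq> lins" and odds_lins: "odds \<subseteq> lins"
proof -
  have "fr ` I \<subseteq> lins" for I using fr_lins by auto
  from fun_space.span_minimal[OF this subspace_lins]
  show "evens \<subseteq> lins" "odds \<subseteq> lins" unfolding evens_def odds_def by this+
qed

private lemma evens_plus_odds: "{x + y |x y. x \<in> evens \<and> y \<in> odds} = lins"
proof
  show "{x + y |x y. x \<in> evens \<and> y \<in> odds} \<subseteq> lins"
    using evens_lins odds_lins fun_space.subspace_add[OF subspace_lins] by blast
  have "fun_subspace {x + y |x y. x \<in> evens \<and> y \<in> odds}"
    unfolding evens_def odds_def by (intro fun_space.subspace_sums fun_space.subspace_span)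
  moreover have "fr i \<in> {x + y |x y. x \<in> evens \<and> y \<in> odds}" if "i < k" for i
  proof (cases "even i")
    case True
    hence "fr i \<in> evens" unfolding evens_def using that k_le by (intro fun_space.span_base) auto
    moreover have "0 \<in> odds" unfolding odds_def by (rule fun_space.span_zero)
    ultimately show ?thesis by (intro CollectI exI[of _ "fr i"] exI[of _ 0]) auto
  next
    case False
    hence "fr i \<in> odds" unfolding odds_def using that k_le by (intro fun_space.span_base) auto
    moreover have "0 \<in> evens" unfolding evens_def by (rule fun_space.span_zero)
    ultimately show ?thesis by (intro CollectI exI[of _ 0] exI[of _ "fr i"]) auto
  qed
  ultimately show "lins \<subseteq> {x + y |x y. x \<in> evens \<and> y \<in> odds}"
    unfolding span_fr[symmetric] by (intro fun_space.span_minimal) auto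
qed

text \<open>
  If the two spans met, both would have dimension greater than \<open>d\<close>, and a basis of all linear
  functions could be chosen with \<open>d\<close> elements in \<open>evens\<close>, \<open>d\<close> elements in \<open>odds\<close> and one of
  the latter in both; moving a single factor turns the nonvanishing product of all
  \<open>(s - 1)\<close>-th powers into an unbalanced one.
\<close>
private lemma evens_Int_odds: "evens \<inter> odds \<subseteq> {0}"
proof (rule ccontr)
  assume n: "\<not> ?thesis"
  define r where "r = fun_dim evens"
  have "fun_dim (evens \<inter> odds) \<noteq> 0" using n by simp
  moreover have dims: "k + fun_dim (evens \<inter> odds) = r + r"
    using fun_space.dim_sums_Int[of evens odds] evens_plus_odds dim_lins dim_evens_odds
    unfolding r_def by (simp add: evens_def odds_def fun_space.subspace_span)
  ultimately have rd: "d < r" using k_eq by linarith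
  \<comment> \<open>Nested bases: \<open>Z\<close> of the intersection, \<open>Y\<close> of
    \<open>odds\<close>, and \<open>W\<close> of \<open>lins\<close>, where \<open>W - Y\<close>
    lies in \<open>evens\<close>.\<close>
  obtain Z where Z: "Z \<subseteq> evens \<inter> odds" "\<not> fun_dependent Z" "card Z = fun_dim (evens \<inter> odds)"
    using fun_space.basis_exists by metis
  obtain Y where Y: "Z \<subseteq> Y" "Y \<subseteq> odds" "\<not> fun_dependent Y" "odds \<subseteq> fun_span Y"
    using fun_space.maximal_independent_subset_extend[of Z odds] Z by blast
  have card_Y: "card Y = r"
    using fun_space.basis_card_eq_dim[OF Y(2) Y(4) Y(3)] dim_evens_odds by (simp add: r_def)
  obtain W where W: "Y \<subseteq> W" "W \<subseteq> Y \<union> evens" "\<not> fun_dependent W" "Y \<union> evens \<subseteq> fun_span W"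
    using fun_space.maximal_independent_subset_extend[of Y "Y \<union> evens"] Y by blast
  have finW: "finite W" using W(3) fun_space.independent_explicit by blast
  have W_lins: "W \<subseteq> lins" using W(2) Y(2) evens_lins odds_lins by blast
  have lins_W: "lins \<subseteq> fun_span W"
  proof -
    have "odds \<subseteq> fun_span W" using Y(4) fun_space.span_mono[OF W(1)] by blast
    thus ?thesis unfolding evens_plus_odds[symmetric] using W(4) fun_space.span_add by blast
  qed
  have card_W: "card W = k"
    using fun_space.basis_card_eq_dim[OF W_lins lins_W W(3)] dim_lins by simp
  \<comment> \<open>\<open>W - Y\<close> supplies only \<open>k - r\<close> elements of
    \<open>evens\<close>; \<open>r - d\<close> elements of \<open>Z\<close> complete them to
    \<open>d\<close>. As \<open>Z\<close> has \<open>2 * (r - d)\<close> elements, some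
    \<open>z\<close> is left over.\<close>
  have "r - d \<le> card Z" using dims Z(3) k_eq by linarith
  then obtain Z' where Z': "Z' \<subseteq> Z" "card Z' = r - d"
    using obtain_subset_with_card_n by metis
  have finZ: "finite Z" using finite_subset[OF subset_trans[OF Y(1) W(1)] finW] .
  have finZ': "finite Z'" using finite_subset[OF Z'(1) finZ] .
  have "card Z' < card Z" using Z' Z(3) dims k_eq rd by linarith
  then obtain z where z: "z \<in> Z" "z \<notin> Z'" using card_mono[OF finZ', of Z] by (meson not_le subsetI)
  define P where "P = (W - Y) \<union> Z'"
  have finP: "finite P" using finW finZ' by (simp add: P_def)
  have cardP: "card P = d"
  proof -
    have "card P = card (W - Y) + card Z'"
      unfolding P_def using finW finZ' Z'(1) Y(1) by (intro card_Un_disjoint) auto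
    also have "card (W - Y) = k - r"
      using card_Diff_subset[OF finite_subset[OF W(1) finW] W(1)] card_W card_Y by simp
    also have "k - r + card Z' = d"
      using Z'(2) rd k_eq card_mono[OF finW W(1)] card_W card_Y by simp
    finally show ?thesis .
  qed
  have PW: "P \<subseteq> W" using Z'(1) Y(1) W(1) by (auto simp: P_def)
  have zP: "z \<notin> P" using z Y(1) by (auto simp: P_def)
  have zW: "z \<in> W" using z Y(1) W(1) by blast
  \<comment> \<open>One of the \<open>s - 1\<close> copies of \<open>z\<close> counts as even, the
    others as odd.\<close>
  let ?T = "W \<times> {..<s - 1}" and ?T1 = "insert (z, 0) (P \<times> {..<s - 1})"
  have "(\<Sum>v\<in>V. \<Prod>i\<in>?T. fst i v) = 0"
  proof (rule sum_prod_unbalanced_0[where TE = ?T1])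
    show "finite ?T" using finW by simp
    show sub: "?T1 \<subseteq> ?T" using PW zW s_ge_2 by auto
    show cT: "card ?T = k * (s - 1)" by (simp add: card_cartesian_product card_W)
    have cT1: "card ?T1 = d * (s - 1) + 1"
      using zP finP by (simp add: card_cartesian_product cardP)
    have "card (?T - ?T1) = card ?T - card ?T1"
      using sub finP by (intro card_Diff_subset) auto
    \<comment> \<open>Guards the truncated subtraction: the complement of \<open>?T1\<close> has
      \<open>d * (s - 1) - 1\<close> elements.\<close>
    moreover have "d * (s - 1) > 0"
    proof -
      have "W \<noteq> {}" using zW by blast
      hence "k > 0" using card_W finW by (auto simp: card_gt_0_iff)
      hence "d > 0" using k_eq by simp
      thus ?thesis using s_ge_2 by simp
    qed
    moreover have "k * (s - 1) = 2 * (d * (s - 1))" using k_eq by simp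
    ultimately show "card ?T1 = card (?T - ?T1) + 2" unfolding cT cT1 by linarith
    fix i
    show "fst i \<in> evens" if "i \<in> ?T1"
    proof -
      have "fst i \<in> insert z P" using that by auto
      thus ?thesis using Z(1) z(1) Z'(1) W(2) unfolding P_def by blast
    qed
    show "fst i \<in> odds" if "i \<in> ?T - ?T1"
    proof -
      have "fst i \<in> W" "fst i \<notin> P" using that by (cases i; auto)+
      thus ?thesis using Y(2) unfolding P_def by blast
    qed
  qed
  hence "(\<Sum>v\<in>V. \<Prod>w\<in>W. w v ^ (s - 1)) = 0"
    using prod_Sigma_power[OF finW, where g = "\<lambda>w. w _" and e = "\<lambda>_. s - 1"] by simp
  thus False using sum_prod_basis_nonzero[OF W_lins lins_W card_W] by simp
qed

text \<open>Scaling the argument by \<open>\<omega>\<close> multiplies the even part of a linearized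
  polynomial by \<open>\<omega>\<close> and the odd part by \<open>\<omega> ^ s\<close>. When both
  parts vanish at \<open>v\<close> separately, they also vanish at
  \<open>\<omega> * v\<close>.\<close>

lemma stable_of_unbalanced_sums:
  assumes \<omega>: "\<omega> ^ (s ^ 2) = \<omega>" and v: "v \<in> V"
  shows "\<omega> * v \<in> V"
\<comment> \<open>The even part below involves \<open>fr k\<close>, which is one of the generators
  of \<open>evens\<close> when \<open>k < n\<close>; for \<open>k = n\<close> the subspace is
  everything.\<close>
proof (cases "k < n")
  case False
  hence "V = UNIV" using card_field card_V k_le by (intro card_subset_eq) auto
  thus ?thesis by simp
next
  case True
  have "fr k \<in> fun_span (fr ` {..<k})" using fr_lins span_fr by simp
  then obtain b where b: "fr k = (\<Sum>f\<in>fr ` {..<k}. (\<lambda>x. b f * f x))"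
    by (auto simp: fun_space.span_finite)
  \<comment> \<open>Expressing \<open>fr k\<close> through lower Frobenius powers gives a linearized
    polynomial that vanishes on \<open>V\<close>; its degree \<open>s ^ k\<close> shows that it has
    no other zeros.\<close>
  define c where "c i = (if i = k then -1 else b (fr i))" for i
  define L where "L v = (\<Sum>i\<le>k. c i * v ^ (s ^ i))" for v
  define P where "P = (\<Sum>i\<le>k. monom (c i) (s ^ i))"
  have poly_P: "poly P v = L v" for v by (simp add: P_def L_def poly_sum poly_monom)
  have L_V: "L v = 0" if v: "v \<in> V" for v
  proof -
    have "fr k v = (\<Sum>i<k. b (fr i) * fr i v)"
      by (subst b) (simp add: sum_fun_apply sum.reindex[OF inj_fr])
    hence "v ^ (s ^ k) = (\<Sum>i<k. b (fr i) * v ^ (s ^ i))" using v by (simp add: fr_def)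
    moreover have "{..k} = insert k {..<k}" by auto
    ultimately show ?thesis by (simp add: L_def c_def)
  qed
  have "coeff P (s ^ k) = (\<Sum>j\<le>k. if j = k then c j else 0)"
    unfolding P_def coeff_sum using s_ge_2 by (intro sum.cong) auto
  hence "P \<noteq> 0" by (auto simp: c_def)
  have "degree P \<le> s ^ k"
    unfolding P_def
  proof (rule degree_sum_le)
    fix j assume "j \<in> {..k}"
    hence "s ^ j \<le> s ^ k" using s_ge_2 by (intro power_increasing) auto
    thus "degree (monom (c j) (s ^ j)) \<le> s ^ k" using degree_monom_le le_trans by blast
  qed simp
  hence "card {v. L v = 0} \<le> card V"
    using card_poly_roots_bound[OF \<open>P \<noteq> 0\<close>] by (simp add: poly_P card_V)
  hence V_eq: "V = {v. L v = 0}" using L_V by (intro card_seteq) auto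
  define E where "E v = (\<Sum>i\<in>{i. i \<le> k \<and> even i}. c i * v ^ (s ^ i))" for v
  define R where "R v = (\<Sum>i\<in>{i. i \<le> k \<and> odd i}. c i * v ^ (s ^ i))" for v
  have L_split: "L v = E v + R v" for v
  proof -
    have "{..k} = {i. i \<le> k \<and> even i} \<union> {i. i \<le> k \<and> odd i}" by auto
    thus ?thesis unfolding L_def E_def R_def by (simp add: sum.union_disjoint[symmetric] disjoint_iff)
  qed
  let ?E = "\<lambda>v. \<Sum>i\<in>{i. i \<le> k \<and> even i}. c i * fr i v"
  let ?R = "\<lambda>v. \<Sum>i\<in>{i. i \<le> k \<and> odd i}. c i * fr i v"
  have E: "?E \<in> evens"
    unfolding evens_def using True by (intro fun_span_scale_sum fun_space.span_base) auto
  have R: "?R \<in> odds"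
    unfolding odds_def using True by (intro fun_span_scale_sum fun_space.span_base) auto
  have "?E v = - ?R v" for v
    using L_V[of v] by (cases "v \<in> V") (auto simp: fr_def L_split E_def R_def eq_neg_iff_add_eq_0)
  hence "?E = (\<lambda>v. - 1 * ?R v)" by auto
  moreover have "(\<lambda>v. - 1 * ?R v) \<in> odds"
    using R unfolding odds_def by (rule fun_space.span_scale)
  ultimately have "?E = 0" using E evens_Int_odds by auto
  hence "?E v = 0 v" by (rule fun_cong)
  hence Ev: "E v = 0" using v by (simp add: E_def fr_def)
  hence Rv: "R v = 0" using L_V[OF v] L_split by simp
  have \<omega>_even: "\<omega> ^ (s ^ (2 * j)) = \<omega>" for j
  proof (induction j)
    case (Suc j)
    have "\<omega> ^ (s ^ (2 * Suc j)) = (\<omega> ^ (s ^ (2 * j))) ^ (s ^ 2)"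
      by (simp add: power2_eq_square ac_simps flip: power_mult)
    thus ?case using Suc \<omega> by simp
  qed simp
  have "E (\<omega> * v) = \<omega> * E v"
    unfolding E_def sum_distrib_left power_mult_distrib
    using \<omega>_even by (intro sum.cong) (auto elim!: evenE simp: ac_simps)
  moreover have "R (\<omega> * v) = \<omega> ^ s * R v"
    unfolding R_def sum_distrib_left power_mult_distrib
  proof (intro sum.cong refl)
    fix i assume "i \<in> {i. i \<le> k \<and> odd i}"
    then obtain j where j: "i = 2 * j + 1" by (auto elim!: oddE)
    have "\<omega> ^ (s ^ i) = (\<omega> ^ (s ^ (2 * j))) ^ s" by (simp only: j power_add power_one_right power_mult)
    thus "c i * (\<omega> ^ (s ^ i) * v ^ (s ^ i)) = \<omega> ^ s * (c i * v ^ (s ^ i))"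
      using \<omega>_even by simp
  qed
  ultimately have "L (\<omega> * v) = 0" using Ev Rv L_split by simp
  thus ?thesis using V_eq by blast
qed

end

end

end

subsection \<open>The code\<close>

lemma minus_1_dvd_power_minus_1: "(x::nat) - 1 dvd x ^ m - 1"
proof (cases "x = 0")
  case False
  show ?thesis
  proof (induction m)
    case (Suc m)
    have "x ^ m \<ge> 1" using False by simp
    hence "x ^ Suc m - 1 = x * (x ^ m - 1) + (x - 1)"
      using False by (simp add: diff_mult_distrib2)
    thus ?case using Suc by simp
  qed simp
qed (simp add: power_0_left)

text \<open>Half of the \<open>2 * m\<close> positions are even. The bound puts 2 into the range of
  \<open>Mset\<close> as soon as some \<open>u\<close> has \<open>E(u) = O(u) + 2\<close>.\<close>

lemma Eq_le: "q > 0 \<Longrightarrow> Eq q (2 * m) u \<le> m * (q - 1)"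
proof -
  assume q: "q > 0"
  have evens: "{i. i < 2 * m \<and> even i} = (\<lambda>j. 2 * j) ` {..<m}" by (auto elim!: evenE)
  have "qdigit q i u \<le> q - 1" for i
    unfolding qdigit_def using mod_less_divisor[OF q, of "u div q ^ i"] by linarith
  hence "Eq q (2 * m) u \<le> (\<Sum>i\<in>{i. i < 2 * m \<and> even i}. q - 1)"
    unfolding Eq_def by (intro sum_mono)
  also have "\<dots> = m * (q - 1)" unfolding evens by (simp add: card_image inj_on_def)
  finally show ?thesis .
qed

definition flat_word :: "'a::field \<Rightarrow> 'a \<Rightarrow> 'a set \<Rightarrow> 'a \<Rightarrow> 'a" where
  "flat_word c h V = (\<lambda>g. if g \<in> (\<lambda>v. h + v) ` V then c else 0)"

lemma sum_flat_word: "(\<Sum>g\<in>UNIV. flat_word c h V g * g ^ u) = c * (\<Sum>v\<in>V. (h + v) ^ u)"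
  for c :: "'a::{field,finite}"
proof -
  have "(\<Sum>g\<in>UNIV. flat_word c h V g * g ^ u) = (\<Sum>g\<in>(\<lambda>v. h + v) ` V. c * g ^ u)"
    by (intro sum.mono_neutral_cong_right) (auto simp: flat_word_def)
  also have "\<dots> = c * (\<Sum>v\<in>V. (h + v) ^ u)"
    by (simp add: sum.reindex sum_distrib_left)
  finally show ?thesis .
qed

lemma hweight_flat_word: "c \<noteq> 0 \<Longrightarrow> hweight (flat_word c h V) = card V"
proof -
  assume "c \<noteq> 0"
  hence "{g. flat_word c h V g \<noteq> 0} = (\<lambda>v. h + v) ` V" by (auto simp: flat_word_def)
  thus ?thesis by (simp add: hweight_def card_image)
qed

text \<open>Every term involving \<open>h\<close> has too few linear factors left. Checks on the
  coset thus become checks on \<open>V\<close> itself.\<close>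

lemma (in finite_subfield) sum_flat_translate:
  assumes V: "subsp V" "card V = s ^ k" and u: "u < s ^ n" "wtq s n u \<le> k * (s - 1)"
  shows "(\<Sum>v\<in>V. (h + v) ^ u) = (\<Sum>v\<in>V. v ^ u)"
proof -
  have s0: "s > 0" using s_ge_2 by simp
  have "(\<Sum>v\<in>V. (h + v) ^ u) = (\<Sum>v\<in>V. \<Prod>i<n. (v ^ (s ^ i) + h ^ (s ^ i)) ^ qdigit s i u)"
    by (simp add: power_digits[OF s0 u(1)] pow_s_add add.commute)
  also have "\<dots> = (\<Sum>v\<in>V. \<Prod>i<n. (v ^ (s ^ i)) ^ qdigit s i u)"
    using u(2) by (intro sum_prod_affine_power_diff[OF V] lin_monomial) (auto simp: wtq_def)
  finally show ?thesis by (simp add: power_digits[OF s0 u(1)])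
qed

locale code_parameters =
  fixes p l q m n \<rho> \<rho>' r :: nat and I :: "nat set" and \<alpha> :: "'a::{field,finite}"
  assumes p: "prime p" and l: "l \<ge> 1" and q: "q = p ^ l"
    and card_field: "card (UNIV :: 'a set) = q ^ n"
    and m: "m \<ge> 1" and n: "n = 2 * m"
    and \<rho>: "\<rho> \<le> n - 1" and \<rho>': "\<rho> = 2 * \<rho>'" and r: "r = \<rho> * (q - 1)"
    and primitive: "primitive_elem \<alpha>"
    and I: "I \<subseteq> Mset q m r" "0 \<in> I" "2 \<notin> I"
begin

text \<open>Dimensions of the flats: \<open>d\<close> over F_{q^2} and \<open>k = n - \<rho>\<close>
  over F_q.\<close>

definition "d = m - \<rho>'"
definition "k = 2 * d"

lemma q_ge_2: "q \<ge> 2"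
  using p l power_increasing[of 1 l p] prime_ge_2_nat[OF p] by (simp add: q)

lemma k: "0 < d" "0 < k" "k \<le> n" and n_eq: "n = k + \<rho>"
  using \<rho> \<rho>' m n by (auto simp: d_def k_def)

lemma total_weight: "n * (q - 1) = k * (q - 1) + r"
  by (simp add: n_eq r add_mult_distrib)

lemma q_CHAR: "q = CHAR('a) ^ l"
  using CHAR_eq_of_card[OF p, where 'a = 'a and N = "l * n"] card_field by (simp add: q power_mult)

sublocale K1: finite_subfield q "TYPE('a)" "subfield_of_size q"
proof
  show "card (subfield_of_size q :: 'a set) = q"
    using minus_1_dvd_power_minus_1[of q n] q_ge_2
    by (intro card_subfield_of_size[OF primitive]) (auto simp: card_field)
qed (use q_CHAR q_ge_2 in auto)

sublocale K2: finite_subfield "q ^ 2" "TYPE('a)" "subfield_of_size (q ^ 2)"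
proof
  have q2: "q ^ 2 \<ge> 2" using q_ge_2 power_increasing[of 1 2 q] by simp
  thus "q ^ 2 \<ge> 2" .
  show "card (subfield_of_size (q ^ 2) :: 'a set) = q ^ 2"
    using minus_1_dvd_power_minus_1[of "q ^ 2" m] q2
    by (intro card_subfield_of_size[OF primitive]) (auto simp: card_field n power_mult)
  show "\<exists>e. q ^ 2 = CHAR('a) ^ e"
    using q_CHAR by (metis power_mult)
qed simp

abbreviation "code \<equiv> Ccode q n \<alpha> r I"

section \<open>Code membership and vanishing power sums\<close>

lemma sum_UNIV: "0 < u \<Longrightarrow> (\<Sum>g\<in>UNIV. x g * g ^ u) = (\<Sum>g\<in>UNIV-{0}. x g * (g::'a) ^ u)"
  by (intro sum.mono_neutral_right) auto

text \<open>For \<open>u = 0\<close> the sum vanishes by the choice of the extended coordinate;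
  otherwise \<open>\<alpha> ^ u\<close> lies in \<open>Zset\<close>, because
  \<open>n * (q - 1) - r = k * (q - 1)\<close>.\<close>

lemma code_low_weight:
  assumes x: "x \<in> code" and u: "u \<le> q ^ n - 1" "wtq q n u < k * (q - 1)"
  shows "(\<Sum>g\<in>UNIV. x g * g ^ u) = 0"
proof (cases "u = 0")
  case True
  have "(\<Sum>g\<in>UNIV. x g) = x 0 + (\<Sum>g\<in>UNIV-{0}. x g)" by (rule sum.remove) auto
  thus ?thesis using x True by (simp add: Ccode_def)
next
  case False
  hence "\<alpha> ^ u \<in> ZrI q n \<alpha> r I"
    using u total_weight by (auto simp: ZrI_def Zset_def)
  thus ?thesis using x u False by (simp add: Ccode_def sum_UNIV)
qed

lemma code_full_weight:
  assumes x: "x \<in> code" and u: "u \<le> q ^ n - 1" "wtq q n u = k * (q - 1)" "Eq q n u = Oq q n u + 2"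
  shows "(\<Sum>g\<in>UNIV. x g * g ^ u) = 0"
proof -
  have u0: "u > 0" using u(2) k q_ge_2 by (cases "u = 0") auto
  have "2 \<le> m * (q - 1)" using Eq_le[of q m u] u(3) q_ge_2 by (simp add: n)
  moreover have "even r" by (simp add: r \<rho>')
  ultimately have "2 \<in> Mset q (n div 2) r - I" using I by (simp add: Mset_def n)
  moreover have "\<alpha> ^ u \<in> Theta q n \<alpha> r 2"
    using u total_weight by (auto simp: Theta_def)
  ultimately have "\<alpha> ^ u \<in> ZrI q n \<alpha> r I" unfolding ZrI_def by blast
  thus ?thesis using x u u0 by (simp add: Ccode_def sum_UNIV)
qed

text \<open>Zeros are given as field elements, so the exponent \<open>w\<close> behind a zero
  \<open>\<alpha> ^ u\<close> may differ from \<open>u\<close>; as \<open>\<alpha>\<close> generates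
  the units, both exponents define the same function there.\<close>

lemma codeI:
  assumes "\<And>g. x g \<in> subfield_of_size q"
    and sums: "\<And>u. u < q ^ n \<Longrightarrow> wtq q n u \<le> k * (q - 1) \<Longrightarrow>
      wtq q n u < k * (q - 1) \<or> Eq q n u \<noteq> Oq q n u \<Longrightarrow> (\<Sum>g\<in>UNIV. x g * g ^ u) = 0"
  shows "x \<in> code"
proof -
  have qn: "q ^ n > 0" using q_ge_2 by simp
  have "(\<Sum>g\<in>UNIV. x g * g ^ 0) = 0"
    using qn k q_ge_2 by (intro sums) auto
  moreover have "(\<Sum>g\<in>UNIV. x g) = x 0 + (\<Sum>g\<in>UNIV-{0}. x g)" by (rule sum.remove) auto
  ultimately have "x 0 = - (\<Sum>g\<in>UNIV-{0}. x g)" by (simp add: eq_neg_iff_add_eq_0)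
  moreover have "(\<Sum>g\<in>UNIV-{0}. x g * g ^ u) = 0" if u: "\<alpha> ^ u \<in> ZrI q n \<alpha> r I" for u
  proof -
    obtain w where w: "\<alpha> ^ u = \<alpha> ^ w" "0 < w" "w \<le> q ^ n - 1" "wtq q n w \<le> k * (q - 1)"
      "wtq q n w < k * (q - 1) \<or> Eq q n w \<noteq> Oq q n w"
    proof -
      from u consider "\<alpha> ^ u \<in> Zset q n \<alpha> r"
        | j where "j \<in> Mset q (n div 2) r - I" "\<alpha> ^ u \<in> Theta q n \<alpha> r j"
        unfolding ZrI_def by blast
      thus ?thesis
      proof cases
        case 1
        then obtain w where "\<alpha> ^ u = \<alpha> ^ w" "0 < w" "w \<le> q ^ n - 1" "wtq q n w + r + 1 \<le> n * (q - 1)"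
          unfolding Zset_def by blast
        thus ?thesis using total_weight by (intro that[of w]) linarith+
      next
        case (2 j)
        then obtain w where w: "\<alpha> ^ u = \<alpha> ^ w" "w \<le> q ^ n - 1" "wtq q n w + r = n * (q - 1)"
          "\<bar>int (Oq q n w) - int (Eq q n w)\<bar> = int j"
          unfolding Theta_def by blast
        have wt: "wtq q n w = k * (q - 1)" using w(3) total_weight by simp
        hence "w > 0" using k q_ge_2 by (cases "w = 0") auto
        \<comment> \<open>Since 0 lies in \<open>I\<close>, only classes with unequal digit sums
          enter \<open>ZrI\<close>.\<close>
        moreover have "j \<noteq> 0" by (rule notI) (use 2(1) I(2) in simp)
        hence "Eq q n w \<noteq> Oq q n w" using w(4) by auto
        ultimately show ?thesis using w wt by (intro that[of w]) auto
      qed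
    qed
    have "g ^ u = g ^ w" if g: "g \<noteq> 0" for g :: 'a
    proof -
      obtain i where "g = \<alpha> ^ i" using primitive_elem_generates[OF primitive g] by blast
      hence "g ^ u = (\<alpha> ^ u) ^ i" "g ^ w = (\<alpha> ^ w) ^ i"
        by (simp_all add: mult.commute flip: power_mult)
      thus ?thesis using w(1) by simp
    qed
    hence "(\<Sum>g\<in>UNIV-{0}. x g * g ^ u) = (\<Sum>g\<in>UNIV-{0}. x g * g ^ w)" by simp
    also have "\<dots> = 0"
      using sums[of w] w qn by (simp add: sum_UNIV)
    finally show ?thesis .
  qed
  ultimately show ?thesis using assms(1) by (simp add: Ccode_def)
qed

lemma card_eq: "(q\<^sup>2) ^ d = q ^ k"
  by (simp add: k_def power_mult)

lemma flat_word_in_code: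
  assumes c: "c \<in> subfield_of_size q"
    and V: "is_subspace_over (subfield_of_size (q ^ 2)) V" "card V = q ^ k"
  shows "flat_word c h V \<in> code"
proof (rule codeI)
  show "flat_word c h V g \<in> subfield_of_size q" for g
    using c K1.K_zero by (simp add: flat_word_def)
  fix u assume u: "u < q ^ n" "wtq q n u \<le> k * (q - 1)"
    "wtq q n u < k * (q - 1) \<or> Eq q n u \<noteq> Oq q n u"
  have "(\<Sum>v\<in>V. (h + v) ^ u) = 0"
    using u by (intro K2.sum_flat_power_0[OF V(1) _ refl q_CHAR u(1), of d])
      (simp_all add: V(2) card_eq k_def)
  thus "(\<Sum>g\<in>UNIV. flat_word c h V g * g ^ u) = 0" by (simp add: sum_flat_word)
qed

section \<open>Minimum weight and the words that attain it\<close>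

lemma code_weight_ge: "x \<in> code \<Longrightarrow> x \<noteq> (\<lambda>_. 0) \<Longrightarrow> q ^ k \<le> hweight x"
  using K1.min_weight_ge[OF card_field k(2,3)] code_low_weight by blast

lemma code_weight_eq:
  assumes x: "x \<in> code" "x \<noteq> (\<lambda>_. 0)" "hweight x = q ^ k"
  shows "\<exists>c h V. c \<in> subfield_of_size q - {0} \<and> is_subspace_over (subfield_of_size (q ^ 2)) V
    \<and> card V = q ^ k \<and> x = flat_word c h V"
proof -
  obtain c h V where cV: "c \<noteq> 0" "K1.subsp V" "card V = q ^ k" "x = flat_word c h V"
    using K1.min_weight_word_flat[OF card_field k(2,3) x(2) _ x(3)] code_low_weight[OF x(1)]
    unfolding flat_word_def by blast
  have "0 \<in> V" using cV(2) by (simp add: is_subspace_over_def)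
  \<comment> \<open>\<open>h\<close> lies in the support, so \<open>c\<close> is an entry of the
    codeword and belongs to F_q.\<close>
  hence "x h = c" unfolding cV(4) flat_word_def by (auto intro: image_eqI[of _ _ 0])
  hence c: "c \<in> subfield_of_size q" using x(1) by (auto simp: Ccode_def)
  have stable: "\<omega> * v \<in> V" if "\<omega> \<in> subfield_of_size (q ^ 2)" "v \<in> V" for \<omega> v
  proof (rule K1.stable_of_unbalanced_sums[OF cV(2,3) card_field _ k_def k(3)])
    show "even n" by (simp add: n)
    show "\<omega> ^ q\<^sup>2 = \<omega>" using that by (simp add: subfield_of_size_def)
    show "v \<in> V" by (rule that)
    fix u assume u: "u < q ^ n" "wtq q n u = k * (q - 1)" "Eq q n u = Oq q n u + 2"
    have "c * (\<Sum>v\<in>V. (h + v) ^ u) = 0"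
      using code_full_weight[OF x(1) _ u(2,3)] u(1) unfolding cV(4) sum_flat_word by simp
    thus "(\<Sum>v\<in>V. v ^ u) = 0"
      using K1.sum_flat_translate[OF cV(2,3) u(1), of h] u(2) cV(1) by simp
  qed
  hence "is_subspace_over (subfield_of_size (q ^ 2)) V"
    using cV(2) by (simp add: is_subspace_over_def)
  thus ?thesis using c cV by blast
qed

text \<open>An F_{q^2}-subspace of dimension \<open>d\<close> supports a word that attains the bound
  of \<open>code_weight_ge\<close>, so the minimum weight is exactly \<open>q ^ k\<close>.\<close>

lemma exists_flat_word:
  obtains x where "x \<in> code" "x \<noteq> (\<lambda>_. 0)" "hweight x = q ^ k"
proof -
  have "card (UNIV :: 'a set) = (q\<^sup>2) ^ m" by (simp add: card_field n power_mult)
  moreover have "d \<le> m" by (simp add: d_def)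
  ultimately obtain V :: "'a set" where V: "K2.subsp V" "card V = q ^ k"
    using K2.exists_subspace_of_dim card_eq by metis
  have "flat_word 1 0 V \<in> code" using V K1.K_one by (intro flat_word_in_code)
  moreover have "hweight (flat_word 1 0 V) = q ^ k" using V(2) by (simp add: hweight_flat_word)
  moreover have "flat_word 1 0 V \<noteq> (\<lambda>_. 0)"
  proof
    assume "flat_word 1 0 V = (\<lambda>_. 0)"
    hence "flat_word 1 0 V 0 = 0" by simp
    thus False using V(1) by (auto simp: flat_word_def is_subspace_over_def)
  qed
  ultimately show ?thesis using that by blast
qed

lemma min_weight_words_eq:
  "min_weight_words code = {x \<in> code. x \<noteq> (\<lambda>_. 0) \<and> hweight x = q ^ k}"
proof (intro equalityI subsetI)
  fix x assume x: "x \<in> min_weight_words code"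
  obtain y where "y \<in> code" "y \<noteq> (\<lambda>_. 0)" "hweight y = q ^ k" by (rule exists_flat_word)
  hence "hweight x \<le> q ^ k" using x unfolding min_weight_words_def by force
  thus "x \<in> {x \<in> code. x \<noteq> (\<lambda>_. 0) \<and> hweight x = q ^ k}"
    using x code_weight_ge[of x] by (auto simp: min_weight_words_def)
next
  fix x assume "x \<in> {x \<in> code. x \<noteq> (\<lambda>_. 0) \<and> hweight x = q ^ k}"
  thus "x \<in> min_weight_words code" using code_weight_ge by (auto simp: min_weight_words_def)
qed

lemma min_weight_words_flat:
  "min_weight_words code = {x. \<exists>c h V. c \<in> subfield_of_size q - {0}
    \<and> is_subspace_over (subfield_of_size (q ^ 2)) V
    \<and> dim_over (subfield_of_size (q ^ 2)) V d \<and> x = flat_word c h V}"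
proof (intro equalityI subsetI)
  fix x assume "x \<in> min_weight_words code"
  then obtain c h V where "c \<in> subfield_of_size q - {0}"
    "is_subspace_over (subfield_of_size (q ^ 2)) V" "card V = q ^ k" "x = flat_word c h V"
    using code_weight_eq unfolding min_weight_words_eq by blast
  thus "x \<in> {x. \<exists>c h V. c \<in> subfield_of_size q - {0}
    \<and> is_subspace_over (subfield_of_size (q ^ 2)) V
    \<and> dim_over (subfield_of_size (q ^ 2)) V d \<and> x = flat_word c h V}"
    using K2.dim_over_iff[of V d] card_eq by auto
next
  fix x :: "'a \<Rightarrow> 'a"
  assume "x \<in> {x. \<exists>c h V. c \<in> subfield_of_size q - {0}
    \<and> is_subspace_over (subfield_of_size (q ^ 2)) V
    \<and> dim_over (subfield_of_size (q ^ 2)) V d \<and> x = flat_word c h V}"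
  then obtain c h V where x: "c \<in> subfield_of_size q - {0}"
    "is_subspace_over (subfield_of_size (q ^ 2)) V"
    "dim_over (subfield_of_size (q ^ 2)) V d" "x = flat_word c h V" by blast
  have V: "card V = q ^ k" using x(3) K2.dim_over_iff[OF x(2)] card_eq by simp
  have w: "hweight x = q ^ k" using x(1,4) V by (simp add: hweight_flat_word)
  moreover have "x \<noteq> (\<lambda>_. 0)"
  proof
    assume "x = (\<lambda>_. 0)"
    hence "hweight x = 0" by (simp add: hweight_def)
    thus False using w q_ge_2 by simp
  qed
  ultimately show "x \<in> min_weight_words code"
    unfolding min_weight_words_eq using x(1,4) V flat_word_in_code[OF _ x(2)] by simp
qed

end

theorem theorem5p7:
  fixes p l q m n \<rho> \<rho>' r :: nat and I :: "nat set" and \<alpha> :: "'a::{field,finite}"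
  assumes "prime p" and "l \<ge> 1" and "q = p ^ l"
    and "card (UNIV :: 'a set) = q ^ n"
    and "m \<ge> 1" and "n = 2 * m"
    and "\<rho> \<le> n - 1" and "\<rho> = 2 * \<rho>'" and "r = \<rho> * (q - 1)"
    and "primitive_elem \<alpha>"
    and "I \<subseteq> Mset q m r" and "0 \<in> I" and "2 \<notin> I"
  shows "min_weight_words (Ccode q n \<alpha> r I) =
    {x. \<exists>c h V. c \<in> subfield_of_size q - {0}
        \<and> is_subspace_over (subfield_of_size (q ^ 2)) V
        \<and> dim_over (subfield_of_size (q ^ 2)) V (m - \<rho>')
        \<and> x = (\<lambda>g. if g \<in> (\<lambda>v. h + v) ` V then c else 0)}"
proof -
  interpret code_parameters p l q m n \<rho> \<rho>' r I \<alpha>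
    using assms by unfold_locales
  show ?thesis
    using min_weight_words_flat unfolding flat_word_def d_def .
qed

end
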